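(* Let $1\le j\le n-1$ and $0\le i\le rj-2$, and let $\omega_{i,j}=t^iy^{-j}dt$ be the corresponding element of the basis of $H^0(X_0,\Omega^1_{X_0})$. Let $d=\max\{0,\deg(v)-2p\}$, let $I_d\in k[t]$ be the inverse of $f$ at order $d+1$ (i.e. in $k[t]/(t^{d+1})$, so $f(t)I_d(t)=1+t^{d+1}P(t)$ with $P\in k[t]$), and let $a$ be the quotient and $b$ the remainder of the Euclidean division of $pj$ by $n$. Put $IP(t)=I_d(t)^{a+1}$, $d^\circ IP=\deg(IP)$; let $IP[k]$, $f[k]$ be the coefficients of $t^k$ in $IP(t)$, $f(t)$, and $v[m]$ the coefficient of $s^m$ in $v(s)$. Let $Q(s)$ be the polynomial $(s^{p-1}+v'(s))/f_2(s)^a$ and $Q[k]$ the coefficient of $s^k$ in $Q$. Then $1\le b\le n-1$ and, with $\nu_{m,k}=p(i+2)+k+m$, $$P_2\bigl(\Phi(\omega_{i,j})\bigr)=\sum_{\mu=0}^{rb-2}\left(\sum_{k=0}^{d^\circ IP}\ \sum_{m=r(n-b)}^{d-(pi+k)}\frac{n(\mu+1)-b(\mu+m+1)}{n}\,IP[k]\cdot f[\mu+m+1]\cdot v[\nu_{m,k}]\;+\;Q[rb-2+p(i+2-rj)-\mu]\right)\frac{t^\mu\,dt}{y^b}$$ in $H^0(X_0,\Omega^1_{X_0})$, where by convention the sum over $m$ is zero if $r(n-b)>d-(pi+k)$.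
   Context: **Curve.** Let $p$ be a prime, $k$ a finite field of characteristic $p$, $W=W(k)$ its ring of Witt vectors, $W_1=W/p^2W$. Let $n\ge 1$ be an integer prime to $p$, $l\ge 1$ an integer with $l\equiv -1 \pmod n$ and $p\nmid l$, and $r=(l+1)/n$. Let $\mathbf f\in W[t]$ be a polynomial of degree $l$ such that $\mathbf f$ and its derivative $\mathbf f'$ generate the unit ideal of $W[t]$, and let $\mathbf f_2(s)=\mathbf f(1/s)s^{l+1}\in W[s]$. Write $f\in k[t]$, $f_2\in k[s]$ for their reductions modulo $p$; it is assumed that $\deg f=l$ and that $f(0)\neq 0$. $X$ is the curve over $\mathrm{Spec}(W)$ obtained by gluing $\mathrm{Spec}(W[t,y]/(y^n-\mathbf f(t)))$ and $\mathrm{Spec}(W[s,z]/(z^n-\mathbf f_2(s)))$ along $t\ne0$, $s\neq 0$ via $t=s^{-1}$, $z=s^ry$. Its special fibre $X_0$ over $k$ is the gluing of $\mathcal U=\mathrm{Spec}(k[t,y]/(y^n-f(t)))$ and $\mathcal V=\mathrm{Spec}(k[s,z]/(z^n-f_2(s)))$. Put $\overline{\mathcal U}=\mathcal U\cap D(y)$; then $X_0=\overline{\mathcal U}\cup\mathcal V$. Coefficients of a polynomial at indices that are negative or larger than the degree are $0$. **Bases.** $H^0(X_0,\Omega^1_{X_0})$ has $k$-basis $\omega_{i,j}=t^iy^{-j}dt$ ($1\le j\le n-1$, $0\le i\le rj-2$). $H^1(X_0,\mathcal O_{X_0})=\mathcal O_{X_0}(\overline{\mathcal U}\cap\mathcal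 V)/(\mathcal O_{X_0}(\overline{\mathcal U})+\mathcal O_{X_0}(\mathcal V))$ has $k$-basis the classes $\overline{h_{i,j}}$ of $h_{i,j}=t^{-i}y^j$ ($1\le j\le n-1$, $1\le i\le rj-1$); $\overline{x}$ denotes the class of $x\in \mathcal O_{X_0}(\overline{\mathcal U}\cap\mathcal V)$. **De Rham cohomology and splitting.** $H^1_{DR}(X_0)$ is the space of triples $(\omega_U,\omega_V,h)\in\Omega^1_{X_0}(\overline{\mathcal U})\oplus\Omega^1_{X_0}(\mathcal V)\oplus\mathcal O_{X_0}(\overline{\mathcal U}\cap\mathcal V)$ with $\omega_V-\omega_U+dh=0$ modulo triples $(dh_U,-dh_V,h_U+h_V)$, $h_U\in\mathcal O_{X_0}(\overline{\mathcal U})$, $h_V\in\mathcal O_{X_0}(\mathcal V)$; $[\cdot]$ denotes the class. Let $\lambda_m$ be the coefficient of $t^m$ in $f$. For $1\le j\le n-1$, $1\le i\le rj-1$ set $$\alpha^{\mathcal U}_{i,j}=\Bigl[\sum_{m=i+1}^l\tfrac{jm-in}{n}\lambda_mt^{m-(i+1)}\Bigr]y^{j-1}\tfrac{dt}{y^{n-1}},\qquad \alpha^{\mathcal V}_{i,j}=\Bigl[\sum_{m=0}^i\tfrac{in-jm}{n}\lambda_ms^{i+1+(n-j)r-2-m}\Bigr]z^{j-1}\tfrac{ds}{z^{n-1}},$$ so that $dh_{i,j}=\alpha^{\mathcal U}_{i,j}+\alpha^{\mathcal V}_{i,j}$; let $\tau$ be the $k$-linear map with $\tau(\overline{h_{i,j}})=(\alpha^{\mathcal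 U}_{i,j},-\alpha^{\mathcal V}_{i,j},h_{i,j})$. One identifies $H^0(X_0,\Omega^1_{X_0})\oplus H^1(X_0,\mathcal O_{X_0})$ with $H^1_{DR}(X_0)$ by $(\omega,x)\mapsto[(\omega|_{\overline{\mathcal U}},\omega|_{\mathcal V},0)]+[\tau(x)]$. $P_2$ (resp. $P_1$) is the projection to $H^0(X_0,\Omega^1_{X_0})$ (resp. $H^1(X_0,\mathcal O_{X_0})$). **Divided Frobenius $\Phi$.** Let $\sigma$ be the Frobenius of $k$ and its lift to $W$ and $W_1$; $Q^\sigma$ means $\sigma$ applied to the coefficients of $Q$; $X_0'$ is the base change of $X_0$ by $\sigma$ (given by $f^\sigma,f_2^\sigma$), with analogous bases $\omega'_{i,j}=t^iy^{-j}dt$, $\overline{h'_{i,j}}=\overline{t^{-i}y^j}$. For $x\in k[s]$, $px\in W_1[s]$ means $p$ times any lift of $x$. Fix $v,c\in k[s]$ with $\mathbf f_2(s)^p-\mathbf f_2^\sigma(s^p)=p\,(v(s)f_2'(s)^p-n\,c(s)f_2(s)^p)$ in $W_1[s]$; then $s\mapsto s^p+pv(s)$, $z\mapsto z^p+pz^pc(s)$ is a lift modulo $p^2$ of the relative Frobenius on $\mathcal V$, while on $\overline{\mathcal U}$ one uses the lift sending $t\mapsto t^p$ and $y\mapsto y^p+py^p\frac{\mathcal P(t)}{n}y^{-np}$, where $p\mathcal P(t)=\mathbf f^\sigma(t^p)-\mathbf f(t)^p$. The polynomial $v$ in the claim is this $v$; it is known that $f_2^{p-1}$ divides $v'+s^{p-1}$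 in $k[s]$, and $a\le p-1$, so $Q$ is a polynomial. Let $F^\#$ be the $k$-linear relative Frobenius ($t\mapsto t^p$, $y\mapsto y^p$, $s\mapsto s^p$, $z\mapsto z^p$), and let $f_U,f_V,h$ be the $F^\#$-linear maps from $\Omega^1_{X'_0}$ (on $\overline{\mathcal U}'$, $\mathcal V'$, $\overline{\mathcal U}'\cap\mathcal V'$) to $\Omega^1_{X_0}(\overline{\mathcal U})$, $\Omega^1_{X_0}(\mathcal V)$, $\mathcal O_{X_0}(\overline{\mathcal U}\cap\mathcal V)$ with $f_U(dt)=t^{p-1}dt$, $f_V(ds)=(s^{p-1}+v'(s))ds$, $h(dt)=t^{2p}v(s)$; they satisfy $f_V-f_U+dh=0$. The Deligne–Illusie map $\Phi':H^0(X_0',\Omega^1_{X_0'})\oplus H^1(X'_0,\mathcal O_{X'_0})\to H^1_{DR}(X_0)$ is $\Phi'(\omega')=[(f_U(\omega'),f_V(\omega'),h(\omega'))]$, $\Phi'(\overline{x'})=[(0,0,F^\#(x'))]$. The divided Frobenius modulo $p$ is the $\sigma$-semilinear map $\Phi:H^0(X_0,\Omega^1_{X_0})\oplus H^1(X_0,\mathcal O_{X_0})\to H^1_{DR}(X_0)$ with $\Phi(\omega_{i,j})=\Phi'(\omega'_{i,j})$, $\Phi(\overline{h_{i,j}})=\Phi'(\overline{h'_{i,j}})$ (its coincidence with the crystalline divided Frobenius modulo $p$ is a cited theorem of Huyghe–Wach). *)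

theory Defs
  imports
    Complex_Main
    "HOL-Library.Poly_Mapping"
    "HOL-Library.Product_Plus"
    "HOL-Computational_Algebra.Computational_Algebra"
begin

section \<open>Witt vectors\<close>

text \<open>
  Integer polynomials in indeterminates indexed by \<open>'v\<close>, and their evaluation in a
  commutative ring.
\<close>

type_synonym 'v zpoly = "('v \<Rightarrow>\<^sub>0 nat) \<Rightarrow>\<^sub>0 int"

definition zvar :: "'v \<Rightarrow> 'v zpoly" where
  "zvar x = Poly_Mapping.single (Poly_Mapping.single x 1) 1"

definition zeval :: "('v \<Rightarrow> 'a::comm_ring_1) \<Rightarrow> 'v zpoly \<Rightarrow> 'a" where
  "zeval e P = (\<Sum>mon\<in>Poly_Mapping.keys P. of_int (Poly_Mapping.lookup P mon) *
      (\<Prod>x\<in>Poly_Mapping.keys mon. e x ^ Poly_Mapping.lookup mon x))"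

definition ghost :: "nat \<Rightarrow> nat \<Rightarrow> (nat \<Rightarrow> 'a::comm_semiring_1) \<Rightarrow> 'a" where
  "ghost p m x = (\<Sum>q\<le>m. of_nat p ^ q * x q ^ (p ^ (m - q)))"

text \<open>
  The solution \<open>S\<^sub>0, S\<^sub>1, \<dots>\<close> of \<open>ghost p m S = G m\<close> for all \<open>m\<close>. The division by \<open>p ^ m\<close> is
  performed on the coefficients; for the two right-hand sides used below it is exact
  (Witt's theorem).
\<close>

fun witt_solve :: "nat \<Rightarrow> (nat \<Rightarrow> 'v zpoly) \<Rightarrow> nat \<Rightarrow> 'v zpoly" where
  "witt_solve p G m = Poly_Mapping.map (\<lambda>a. a div int (p ^ m))
     (G m - (\<Sum>q<m. of_nat p ^ q * witt_solve p G q ^ (p ^ (m - q))))"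

declare witt_solve.simps [simp del]

definition witt_sum :: "nat \<Rightarrow> nat \<Rightarrow> (nat + nat) zpoly" where
  "witt_sum p = witt_solve p (\<lambda>m. ghost p m (zvar \<circ> Inl) + ghost p m (zvar \<circ> Inr))"

definition witt_product :: "nat \<Rightarrow> nat \<Rightarrow> (nat + nat) zpoly" where
  "witt_product p = witt_solve p (\<lambda>m. ghost p m (zvar \<circ> Inl) * ghost p m (zvar \<circ> Inr))"

text \<open>
  The ring \<open>'w\<close> is the ring of \<open>p\<close>-typical Witt vectors over \<open>'k\<close>; \<open>wc x\<close> is the sequence
  of Witt components of \<open>x\<close>.
\<close>

definition witt_vectors :: "nat \<Rightarrow> ('w::comm_ring_1 \<Rightarrow> nat \<Rightarrow> 'k::comm_ring_1) \<Rightarrow> bool" where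
  "witt_vectors p wc \<longleftrightarrow> bij wc \<and>
     (\<forall>x y m. wc (x + y) m = zeval (case_sum (wc x) (wc y)) (witt_sum p m)) \<and>
     (\<forall>x y m. wc (x * y) m = zeval (case_sum (wc x) (wc y)) (witt_product p m))"

definition witt_red :: "('w \<Rightarrow> nat \<Rightarrow> 'k) \<Rightarrow> 'w \<Rightarrow> 'k" where
  "witt_red wc x = wc x 0"

definition witt_frob :: "nat \<Rightarrow> ('w \<Rightarrow> nat \<Rightarrow> 'k::comm_ring_1) \<Rightarrow> 'w \<Rightarrow> 'w" where
  "witt_frob p wc x = inv wc (\<lambda>m. wc x m ^ p)"

text \<open>
  For \<open>E\<close> over \<open>W\<close> and \<open>x\<close> over \<open>k\<close>: the equation \<open>E = p x\<close> over \<open>W/p\<^sup>2W\<close>, where \<open>p x\<close> is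
  \<open>p\<close> times any lift of \<open>x\<close>.
\<close>

definition eq_p_times ::
    "nat \<Rightarrow> ('w::comm_ring_1 \<Rightarrow> nat \<Rightarrow> 'k::comm_ring_1) \<Rightarrow> 'w poly \<Rightarrow> 'k poly \<Rightarrow> bool" where
  "eq_p_times p wc E x \<longleftrightarrow>
     (\<exists>L. map_poly (witt_red wc) L = x \<and> [:of_nat (p ^ 2):] dvd E - smult (of_nat p) L)"

definition poly_at_infinity :: "nat \<Rightarrow> 'w::comm_ring_1 poly \<Rightarrow> 'w poly" where
  "poly_at_infinity l F = (\<Sum>m\<le>l. monom (coeff F m) (l + 1 - m))"

definition frob_poly :: "nat \<Rightarrow> 'k::comm_ring_1 poly \<Rightarrow> 'k poly" where
  "frob_poly p f = map_poly (\<lambda>x. x ^ p) f"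


section \<open>The curve\<close>

text \<open>
  The curve is integral, so all rings of functions are realised inside the function field
  \<open>K = Frac (k[t,y]/(y\<^sup>n - f(t)))\<close> (type \<open>'a\<close>), with restriction maps the inclusions. As \<open>p\<close>
  does not divide \<open>n\<close>, the module of differentials of \<open>K/k\<close> is \<open>K dt\<close>: a rational
  differential form \<open>g dt\<close> is represented by \<open>g\<close>, and \<open>der\<close> is \<open>d\<close>, i.e. the \<open>k\<close>-derivation
  with \<open>der t = 1\<close>.
\<close>

record ('k, 'a) ffield =
  emb :: "'k \<Rightarrow> 'a"
  tt :: 'a
  yy :: 'a
  der :: "'a \<Rightarrow> 'a"

definition ev :: "('k::field, 'a::field, 'z) ffield_scheme \<Rightarrow> 'a \<Rightarrow> 'k poly \<Rightarrow> 'a" where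
  "ev C x q = poly (map_poly (emb C) q) x"

text \<open>Evaluation of a polynomial in two variables; the outer variable goes to the second point.\<close>

definition ev2 :: "('k::field, 'a::field, 'z) ffield_scheme \<Rightarrow> 'a \<Rightarrow> 'a \<Rightarrow> 'k poly poly \<Rightarrow> 'a" where
  "ev2 C x z P = poly (map_poly (ev C x) P) z"

definition is_ring_hom :: "('a::ring_1 \<Rightarrow> 'b::ring_1) \<Rightarrow> bool" where
  "is_ring_hom h \<longleftrightarrow> h 1 = 1 \<and> (\<forall>x y. h (x + y) = h x + h y) \<and> (\<forall>x y. h (x * y) = h x * h y)"

definition function_field :: "nat \<Rightarrow> 'k::field poly \<Rightarrow> ('k, 'a::field) ffield \<Rightarrow> bool" where
  "function_field n f C \<longleftrightarrow>
     is_ring_hom (emb C) \<and>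
     (\<forall>P. ev2 C (tt C) (yy C) P = 0 \<longleftrightarrow> (monom 1 n - [:f:]) dvd P) \<and>
     (\<forall>g. \<exists>A B. ev2 C (tt C) (yy C) B \<noteq> 0 \<and> g = ev2 C (tt C) (yy C) A / ev2 C (tt C) (yy C) B) \<and>
     (\<forall>g h. der C (g + h) = der C g + der C h) \<and>
     (\<forall>g h. der C (g * h) = g * der C h + h * der C g) \<and>
     (\<forall>x. der C (emb C x) = 0) \<and> der C (tt C) = 1"

definition ss :: "('k, 'a::field) ffield \<Rightarrow> 'a" where
  "ss C = inverse (tt C)"

definition zz :: "nat \<Rightarrow> ('k, 'a::field) ffield \<Rightarrow> 'a" where
  "zz r C = ss C ^ r * yy C"

text \<open>
  The rings of functions on \<open>U \<inter> D(y)\<close>, on \<open>V\<close>, and on their intersection, which is \<open>D(ty)\<close>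
  in \<open>U\<close>.
\<close>

definition OU :: "('k::field, 'a::field) ffield \<Rightarrow> 'a set" where
  "OU C = {ev2 C (tt C) (yy C) P / yy C ^ m |P m. True}"

definition OV :: "nat \<Rightarrow> ('k::field, 'a::field) ffield \<Rightarrow> 'a set" where
  "OV r C = range (ev2 C (ss C) (zz r C))"

definition OUV :: "('k::field, 'a::field) ffield \<Rightarrow> 'a set" where
  "OUV C = {ev2 C (tt C) (yy C) P / (tt C * yy C) ^ m |P m. True}"

text \<open>
  The differentials on an affine open with ring of functions \<open>A\<close>: the forms \<open>\<Sum>q<m. g q dh q\<close>
  with \<open>g q\<close>, \<open>h q\<close> in \<open>A\<close>. This is the module of Kaehler differentials of \<open>A\<close>, which is
  torsion-free as the curve is smooth.
\<close>

definition Omega :: "('k, 'a::field) ffield \<Rightarrow> 'a set \<Rightarrow> 'a set" where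
  "Omega C A = {\<Sum>q<m. g q * der C (h q) |(m::nat) g h. \<forall>q<m. g q \<in> A \<and> h q \<in> A}"

definition coset :: "'b::ab_group_add set \<Rightarrow> 'b \<Rightarrow> 'b set" where
  "coset B x = {y. y - x \<in> B}"

definition H0 :: "nat \<Rightarrow> ('k::field, 'a::field) ffield \<Rightarrow> 'a set" where
  "H0 r C = Omega C (OU C) \<inter> Omega C (OV r C)"

definition OU_plus_OV :: "nat \<Rightarrow> ('k::field, 'a::field) ffield \<Rightarrow> 'a set" where
  "OU_plus_OV r C = {hU + hV |hU hV. hU \<in> OU C \<and> hV \<in> OV r C}"

definition H1O :: "nat \<Rightarrow> ('k::field, 'a::field) ffield \<Rightarrow> 'a set set" where
  "H1O r C = coset (OU_plus_OV r C) ` OUV C"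

definition ZDR :: "nat \<Rightarrow> ('k::field, 'a::field) ffield \<Rightarrow> ('a \<times> 'a \<times> 'a) set" where
  "ZDR r C = {(\<omega>U, \<omega>V, h). \<omega>U \<in> Omega C (OU C) \<and> \<omega>V \<in> Omega C (OV r C) \<and> h \<in> OUV C \<and>
     \<omega>V - \<omega>U + der C h = 0}"

definition BDR :: "nat \<Rightarrow> ('k::field, 'a::field) ffield \<Rightarrow> ('a \<times> 'a \<times> 'a) set" where
  "BDR r C = {(der C hU, - der C hV, hU + hV) |hU hV. hU \<in> OU C \<and> hV \<in> OV r C}"

definition HDR :: "nat \<Rightarrow> ('k::field, 'a::field) ffield \<Rightarrow> ('a \<times> 'a \<times> 'a) set set" where
  "HDR r C = coset (BDR r C) ` ZDR r C"


section \<open>Bases and the splitting of de Rham cohomology\<close>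

definition omega_index :: "nat \<Rightarrow> nat \<Rightarrow> (nat \<times> nat) set" where
  "omega_index n r = {(i, j). 1 \<le> j \<and> j + 1 \<le> n \<and> i + 2 \<le> r * j}"

definition h_index :: "nat \<Rightarrow> nat \<Rightarrow> (nat \<times> nat) set" where
  "h_index n r = {(i, j). 1 \<le> j \<and> j + 1 \<le> n \<and> 1 \<le> i \<and> i + 1 \<le> r * j}"

definition omega :: "('k, 'a::field) ffield \<Rightarrow> nat \<times> nat \<Rightarrow> 'a" where
  "omega C = (\<lambda>(i, j). tt C ^ i / yy C ^ j)"

definition hfun :: "('k, 'a::field) ffield \<Rightarrow> nat \<times> nat \<Rightarrow> 'a" where
  "hfun C = (\<lambda>(i, j). yy C ^ j / tt C ^ i)"

definition omega_coords ::
    "nat \<Rightarrow> nat \<Rightarrow> ('k::field, 'a::field) ffield \<Rightarrow> 'a \<Rightarrow> nat \<times> nat \<Rightarrow> 'k" where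
  "omega_coords n r C \<omega> = (THE u. (\<forall>e. e \<notin> omega_index n r \<longrightarrow> u e = 0) \<and>
     \<omega> = (\<Sum>e\<in>omega_index n r. emb C (u e) * omega C e))"

definition h_coords ::
    "nat \<Rightarrow> nat \<Rightarrow> ('k::field, 'a::field) ffield \<Rightarrow> 'a set \<Rightarrow> nat \<times> nat \<Rightarrow> 'k" where
  "h_coords n r C X = (THE u. (\<forall>e. e \<notin> h_index n r \<longrightarrow> u e = 0) \<and>
     X = coset (OU_plus_OV r C) (\<Sum>e\<in>h_index n r. emb C (u e) * hfun C e))"

definition alphaU :: "nat \<Rightarrow> 'k::field poly \<Rightarrow> ('k, 'a::field) ffield \<Rightarrow> nat \<times> nat \<Rightarrow> 'a" where
  "alphaU n f C = (\<lambda>(i, j).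
     (\<Sum>m = i + 1..degree f.
        emb C ((of_nat (j * m) - of_nat (i * n)) / of_nat n * coeff f m) * tt C ^ (m - (i + 1)))
     * yy C ^ (j - 1) / yy C ^ (n - 1))"

text \<open>The last factor is \<open>ds\<close>, all forms being written as multiples of \<open>dt\<close>.\<close>

definition alphaV :: "nat \<Rightarrow> nat \<Rightarrow> 'k::field poly \<Rightarrow> ('k, 'a::field) ffield \<Rightarrow> nat \<times> nat \<Rightarrow> 'a" where
  "alphaV n r f C = (\<lambda>(i, j).
     (\<Sum>m = 0..i.
        emb C ((of_nat (i * n) - of_nat (j * m)) / of_nat n * coeff f m)
        * ss C ^ (i + 1 + (n - j) * r - 2 - m))
     * zz r C ^ (j - 1) / zz r C ^ (n - 1) * der C (ss C))"

definition tau ::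
    "nat \<Rightarrow> nat \<Rightarrow> 'k::field poly \<Rightarrow> ('k, 'a::field) ffield \<Rightarrow> 'a set \<Rightarrow> 'a \<times> 'a \<times> 'a" where
  "tau n r f C X = (\<Sum>e\<in>h_index n r. let u = emb C (h_coords n r C X e) in
     (u * alphaU n f C e, - (u * alphaV n r f C e), u * hfun C e))"

definition split_DR ::
    "nat \<Rightarrow> nat \<Rightarrow> 'k::field poly \<Rightarrow> ('k, 'a::field) ffield \<Rightarrow> 'a \<times> 'a set \<Rightarrow> ('a \<times> 'a \<times> 'a) set" where
  "split_DR n r f C = (\<lambda>(\<omega>, X). coset (BDR r C) ((\<omega>, \<omega>, 0) + tau n r f C X))"

definition proj2 ::
    "nat \<Rightarrow> nat \<Rightarrow> 'k::field poly \<Rightarrow> ('k, 'a::field) ffield \<Rightarrow> ('a \<times> 'a \<times> 'a) set \<Rightarrow> 'a" where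
  "proj2 n r f C \<xi> = fst (the_inv_into (H0 r C \<times> H1O r C) (split_DR n r f C) \<xi>)"


section \<open>Divided Frobenius\<close>

text \<open>
  In this section \<open>C\<close> is the function field of \<open>X\<^sub>0\<close>, \<open>C'\<close> that of its base change \<open>X\<^sub>0'\<close>,
  and \<open>Fs\<close> the relative Frobenius \<open>F\<^sup>#\<close> on functions.
\<close>

definition relative_frobenius ::
    "nat \<Rightarrow> ('k, 'b::field) ffield \<Rightarrow> ('k, 'a::field) ffield \<Rightarrow> ('b \<Rightarrow> 'a) \<Rightarrow> bool" where
  "relative_frobenius p C' C Fs \<longleftrightarrow>
     is_ring_hom Fs \<and> (\<forall>x. Fs (emb C' x) = emb C x) \<and>
     Fs (tt C') = tt C ^ p \<and> Fs (yy C') = yy C ^ p"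

text \<open>
  The \<open>F\<^sup>#\<close>-linear maps determined by \<open>dt \<mapsto> t\<^bsup>p-1\<^esup> dt\<close>, \<open>ds \<mapsto> (s\<^bsup>p-1\<^esup> + v'(s)) ds\<close> and
  \<open>dt \<mapsto> t\<^bsup>2p\<^esup> v(s)\<close>. A form \<open>g dt\<close> on \<open>X\<^sub>0'\<close> equals \<open>(g / (ds/dt)) ds\<close>.
\<close>

definition fU :: "nat \<Rightarrow> ('k, 'a::field) ffield \<Rightarrow> ('b \<Rightarrow> 'a) \<Rightarrow> 'b \<Rightarrow> 'a" where
  "fU p C Fs \<omega> = Fs \<omega> * tt C ^ (p - 1)"

definition fV ::
    "nat \<Rightarrow> 'k::field poly \<Rightarrow> ('k, 'b::field) ffield \<Rightarrow> ('k, 'a::field) ffield \<Rightarrow> ('b \<Rightarrow> 'a) \<Rightarrow> 'b \<Rightarrow> 'a" where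
  "fV p v C' C Fs \<omega> =
     Fs (\<omega> / der C' (ss C')) * (ss C ^ (p - 1) + ev C (ss C) (pderiv v)) * der C (ss C)"

definition hUV ::
    "nat \<Rightarrow> 'k::field poly \<Rightarrow> ('k, 'a::field) ffield \<Rightarrow> ('b \<Rightarrow> 'a) \<Rightarrow> 'b \<Rightarrow> 'a" where
  "hUV p v C Fs \<omega> = Fs \<omega> * tt C ^ (2 * p) * ev C (ss C) v"

text \<open>The union is over the representatives \<open>x\<close> of the class \<open>X\<close>; all its members coincide.\<close>

definition Phi' ::
    "nat \<Rightarrow> nat \<Rightarrow> 'k::field poly \<Rightarrow> ('k, 'b::field) ffield \<Rightarrow> ('k, 'a::field) ffield \<Rightarrow> ('b \<Rightarrow> 'a) \<Rightarrow>
     'b \<times> 'b set \<Rightarrow> ('a \<times> 'a \<times> 'a) set" where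
  "Phi' p r v C' C Fs = (\<lambda>(\<omega>, X).
     \<Union>x\<in>X. coset (BDR r C) ((fU p C Fs \<omega>, fV p v C' C Fs \<omega>, hUV p v C Fs \<omega>) + (0, 0, Fs x)))"

text \<open>The Frobenius-semilinear map with \<open>\<omega>\<^sub>i\<^sub>j \<mapsto> \<omega>'\<^sub>i\<^sub>j\<close> and \<open>h\<^sub>i\<^sub>j \<mapsto> h'\<^sub>i\<^sub>j\<close>.\<close>

definition base_change ::
    "nat \<Rightarrow> nat \<Rightarrow> nat \<Rightarrow> ('k::field, 'b::field) ffield \<Rightarrow> ('k, 'a::field) ffield \<Rightarrow>
     'a \<times> 'a set \<Rightarrow> 'b \<times> 'b set" where
  "base_change p n r C' C = (\<lambda>(\<omega>, X).
     (\<Sum>e\<in>omega_index n r. emb C' (omega_coords n r C \<omega> e ^ p) * omega C' e,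
      coset (OU_plus_OV r C') (\<Sum>e\<in>h_index n r. emb C' (h_coords n r C X e ^ p) * hfun C' e)))"

definition Phi ::
    "nat \<Rightarrow> nat \<Rightarrow> nat \<Rightarrow> 'k::field poly \<Rightarrow> ('k, 'b::field) ffield \<Rightarrow> ('k, 'a::field) ffield \<Rightarrow>
     ('b \<Rightarrow> 'a) \<Rightarrow> 'a \<times> 'a set \<Rightarrow> ('a \<times> 'a \<times> 'a) set" where
  "Phi p n r v C' C Fs x = Phi' p r v C' C Fs (base_change p n r C' C x)"

definition coeff_int :: "'k::zero poly \<Rightarrow> int \<Rightarrow> 'k" where
  "coeff_int q m = (if m < 0 then 0 else coeff q (nat m))"

end

theory Submission
  imports Defs
begin

text \<open>
  Write \<open>G = t\<^bsup>pi\<^esup> / y\<^bsup>pj\<^esup>\<close>, the image of \<open>\<omega>'\<^sub>i\<^sub>j\<close> under \<open>F\<^sup>#\<close>. The class to be projected is that of the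
  cocycle with function part \<open>\<eta> = G t\<^bsup>2p\<^esup> v(s)\<close>; that it is a cocycle is immediate, since \<open>G t\<^bsup>2p\<^esup>\<close> is a
  \<open>p\<close>-th power and has differential zero.

  As \<open>p j = a n + b\<close>, the function \<open>\<eta>\<close> is \<open>y\<^bsup>n-b\<^esup>\<close> times the element
  \<open>t\<^bsup>p(i+2)\<^esup> v(s) f\<^bsup>-(a+1)\<^esup>\<close> of \<open>k[t, 1/t, 1/f]\<close>. Replacing \<open>f\<^bsup>-(a+1)\<^esup>\<close> by the polynomial \<open>IP\<close> costs a
  multiple of \<open>t\<^bsup>d+1\<^esup> / f\<^bsup>a+1\<^esup>\<close>, and \<open>d\<close> is chosen so that this error has no pole at \<open>t = 0\<close>
  (\<open>h_component\<close>). So up to a function \<open>h\<^sub>U\<close> on \<open>U \<inter> D(y)\<close> the function \<open>\<eta>\<close> is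
  \<open>\<Sum> c\<^sub>m t\<^bsup>-m\<^esup> y\<^bsup>n-b\<^esup>\<close> over \<open>m \<ge> 1\<close>, with \<open>c\<^sub>m = \<Sum>\<^sub>k IP[k] v[p(i+2)+k+m]\<close>. The terms with
  \<open>m < r(n-b)\<close> are multiples of basis elements \<open>h\<^bsub>m,n-b\<^esub>\<close>; those with \<open>m \<ge> r(n-b)\<close> form a function \<open>h\<^sub>V\<close>
  on \<open>V\<close>. Subtracting the coboundary of \<open>(h\<^sub>U, h\<^sub>V)\<close> and the image under \<open>\<tau>\<close> of the class of \<open>\<eta>\<close> leaves a
  form \<open>\<omega>\<close> with zero function part, and \<open>\<omega>\<close> is the projection.

  The form \<open>\<omega>\<close> has two expressions. On \<open>V\<close> it is the sum of the Frobenius image of \<open>\<omega>'\<^sub>i\<^sub>j\<close>, of \<open>dh\<^sub>V\<close> and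
  of multiples of the \<open>\<alpha>\<^sup>V\<close>; since \<open>d(t\<^bsup>-m\<^esup> y\<^bsup>n-b\<^esup>) = \<alpha>\<^sup>U + \<alpha>\<^sup>V\<close>, this displays \<open>\<omega> y\<^sup>b\<close> as a Laurent
  polynomial in \<open>t\<close>, whose terms of nonnegative exponent are those in the statement: \<open>Q\<close> comes from the
  Frobenius image (\<open>V_component\<close>) and the double sum from the \<open>\<alpha>\<^sup>U\<close>-parts of \<open>dh\<^sub>V\<close> (\<open>alphaU_coeffs\<close>).
  The other expression, on \<open>U \<inter> D(y)\<close>, shows that \<open>\<omega> y\<^sup>b\<close> lies in \<open>k[t, 1/f]\<close>. As \<open>f(0) \<noteq> 0\<close>, the terms of
  negative exponent therefore cancel (\<open>constant_of_regular_at_0\<close>).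

  Two further facts are needed. The splitting of de Rham cohomology must be injective for the
  projection to be determined; this is \<open>split_DR_inj\<close>, which rests on the \<open>h\<^sub>i\<^sub>j\<close> being a basis of
  \<open>H\<^sup>1(X\<^sub>0, \<O>)\<close> and on global functions being constant. And \<open>f2\<^sup>a\<close> must divide
  \<open>s\<^bsup>p-1\<^esup> + v'\<close> so that \<open>Q\<close> is an honest quotient; this follows by differentiating the congruence that
  defines \<open>v\<close> (\<open>power_dvd_Frobenius_on_ds\<close>), where it matters that \<open>p \<noteq> 0\<close> in the Witt vectors.
\<close>

section \<open>Witt vectors to length two\<close>

definition mon_eval :: "('v \<Rightarrow> 'a::comm_ring_1) \<Rightarrow> ('v \<Rightarrow>\<^sub>0 nat) \<Rightarrow> 'a" where
  "mon_eval e u = (\<Prod>x\<in>Poly_Mapping.keys u. e x ^ Poly_Mapping.lookup u x)"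

lemma mon_eval_superset:
  "finite A \<Longrightarrow> Poly_Mapping.keys u \<subseteq> A \<Longrightarrow> mon_eval e u = (\<Prod>x\<in>A. e x ^ Poly_Mapping.lookup u x)"
  unfolding mon_eval_def by (rule prod.mono_neutral_left) (auto simp: in_keys_iff)

lemma mon_eval_add: "mon_eval e (u + w) = mon_eval e u * mon_eval e w"
proof -
  let ?A = "Poly_Mapping.keys u \<union> Poly_Mapping.keys w"
  have s: "Poly_Mapping.keys (u + w) \<subseteq> ?A" by (rule keys_add)
  show ?thesis
    by (subst (1 2 3) mon_eval_superset[where A="?A"])
       (use s in \<open>auto simp: lookup_add power_add prod.distrib\<close>)
qed

lemma zeval_superset:
  "finite A \<Longrightarrow> Poly_Mapping.keys P \<subseteq> A \<Longrightarrow>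
    zeval e P = (\<Sum>u\<in>A. of_int (Poly_Mapping.lookup P u) * mon_eval e u)"
  unfolding zeval_def mon_eval_def by (rule sum.mono_neutral_left) (auto simp: in_keys_iff)

lemma zeval_0 [simp]: "zeval e 0 = 0"
  by (simp add: zeval_def)

lemma zeval_add: "zeval e (P + Q) = zeval e P + zeval e Q"
proof -
  let ?A = "Poly_Mapping.keys P \<union> Poly_Mapping.keys Q"
  have s: "Poly_Mapping.keys (P + Q) \<subseteq> ?A" by (rule keys_add)
  show ?thesis
    by (subst (1 2 3) zeval_superset[where A="?A"])
       (use s in \<open>auto simp: lookup_add sum.distrib distrib_right\<close>)
qed

lemma zeval_single: "zeval e (Poly_Mapping.single u a) = of_int a * mon_eval e u"
  by (subst zeval_superset[where A="{u}"]) (auto simp: lookup_single)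

lemma zpoly_induct [case_names zero single]:
  fixes P :: "'v zpoly"
  assumes "\<Phi> 0" "\<And>P u a. \<Phi> P \<Longrightarrow> \<Phi> (Poly_Mapping.single u a + P)"
  shows "\<Phi> P"
proof (induction P rule: update_induct)
  case const show ?case by (fact assms(1))
next
  case (update P u a)
  have "Poly_Mapping.update u a P = Poly_Mapping.single u a + P"
    using update(1) by (intro poly_mapping_eqI)
      (auto simp: lookup_update lookup_add lookup_single when_def in_keys_iff)
  with assms(2)[OF update(3)] show ?case by simp
qed

lemma zeval_single_mult:
  "zeval e (Poly_Mapping.single u a * Q) = of_int a * mon_eval e u * zeval e Q"
proof (induction Q rule: zpoly_induct)
  case (single P w b)
  then show ?case by (simp add: distrib_left zeval_add mult_single zeval_single mon_eval_add mult_ac)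
qed simp

lemma zeval_mult: "zeval e (P * Q) = zeval e P * zeval e Q"
proof (induction P rule: zpoly_induct)
  case (single P w b)
  then show ?case by (simp add: distrib_right zeval_add zeval_single_mult zeval_single)
qed simp

lemma zeval_1 [simp]: "zeval e 1 = 1"
  using zeval_single[of e 0 1] by (simp add: mon_eval_def)

lemma zeval_power: "zeval e (P ^ m) = zeval e P ^ m"
  by (induction m) (simp_all add: zeval_mult)

lemma zeval_of_nat: "zeval e (of_nat m) = of_nat m"
  by (induction m) (simp_all add: zeval_add)

lemma zeval_zvar [simp]: "zeval e (zvar x) = e x"
  by (simp add: zvar_def zeval_single mon_eval_def)

lemma poly_mapping_map_ident [simp]: "Poly_Mapping.map (\<lambda>a. a) P = P"
  by (intro poly_mapping_eqI) (simp add: Poly_Mapping.map.rep_eq when_def)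

lemma map_div_of_nat_mult:
  assumes "m > 0"
  shows "Poly_Mapping.map (\<lambda>a. a div int m) (of_nat m * P :: 'v zpoly) = P"
proof (rule poly_mapping_eqI)
  fix u
  have "of_nat m * P = Poly_Mapping.map ((*) (int m)) P"
    by (simp add: mult_map_scale_conv_mult single_of_nat[symmetric] del: single_of_nat)
  then have "Poly_Mapping.lookup (of_nat m * P) u = int m * Poly_Mapping.lookup P u"
    by (simp add: Poly_Mapping.map.rep_eq when_def)
  then show "Poly_Mapping.lookup (Poly_Mapping.map (\<lambda>a. a div int m) (of_nat m * P)) u =
      Poly_Mapping.lookup P u"
    using assms by (simp add: Poly_Mapping.map.rep_eq when_def)
qed

lemma witt_solve_0: "witt_solve p G 0 = G 0"
  by (subst witt_solve.simps) simp

lemma witt_sum_0: "witt_sum p 0 = zvar (Inl 0) + zvar (Inr 0)"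
  by (simp add: witt_sum_def witt_solve_0 ghost_def)

lemma witt_product_0: "witt_product p 0 = zvar (Inl 0) * zvar (Inr 0)"
  by (simp add: witt_product_def witt_solve_0 ghost_def)

text \<open>
  The only Witt polynomials needed are those in degrees \<open>0\<close> and \<open>1\<close>. For them exactness of the
  division is the congruence \<open>G 1 = G 0 ^ p\<close> modulo \<open>p\<close>, with an explicit quotient.
\<close>

lemma witt_solve_1:
  fixes G :: "nat \<Rightarrow> 'v zpoly"
  assumes "p > 0" "G 1 = G 0 ^ p + of_nat p * P"
  shows "witt_solve p G 1 = P"
proof -
  have "witt_solve p G 1 = Poly_Mapping.map (\<lambda>a. a div int p) (G 1 - G 0 ^ p)"
    by (subst witt_solve.simps) (simp add: witt_solve_0)
  also have "G 1 - G 0 ^ p = of_nat p * P" unfolding assms(2) by simp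
  finally show ?thesis using assms(1) by (simp add: map_div_of_nat_mult)
qed

text \<open>
  This is \<open>(x\<^sup>p + y\<^sup>p - (x + y)\<^sup>p) / p\<close>, written with integral coefficients so that it makes sense
  in characteristic \<open>p\<close>. It is the carry in the addition of second Witt components.
\<close>

definition frobenius_defect :: "nat \<Rightarrow> 'a::comm_ring_1 \<Rightarrow> 'a \<Rightarrow> 'a" where
  "frobenius_defect p x y = - (\<Sum>k\<in>{1..<p}. of_nat ((p choose k) div p) * x ^ k * y ^ (p - k))"

lemma frobenius_defect:
  fixes x y :: "'a::comm_ring_1"
  assumes "prime p"
  shows "x ^ p + y ^ p = (x + y) ^ p + of_nat p * frobenius_defect p x y"
proof -
  have p: "p > 0" using assms prime_gt_0_nat by blast
  have split: "{..p} = insert 0 (insert p {1..<p})" using p by auto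
  have "(x + y) ^ p = (\<Sum>k\<le>p. of_nat (p choose k) * x ^ k * y ^ (p - k))"
    by (simp add: binomial_ring)
  also have "\<dots> = y ^ p + (x ^ p + (\<Sum>k\<in>{1..<p}. of_nat (p choose k) * x ^ k * y ^ (p - k)))"
    unfolding split using p by simp
  also have "(\<Sum>k\<in>{1..<p}. of_nat (p choose k) * x ^ k * y ^ (p - k)) =
      of_nat p * (\<Sum>k\<in>{1..<p}. of_nat ((p choose k) div p) * x ^ k * y ^ (p - k))"
    unfolding sum_distrib_left
  proof (rule sum.cong)
    fix k assume k: "k \<in> {1..<p}"
    then have "p dvd p choose k" using assms by (intro dvd_choose_prime) auto
    then have "(of_nat (p choose k) :: 'a) = of_nat p * of_nat ((p choose k) div p)"
      by (metis of_nat_mult dvd_mult_div_cancel)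
    then show "of_nat (p choose k) * x ^ k * y ^ (p - k) =
        of_nat p * (of_nat ((p choose k) div p) * x ^ k * y ^ (p - k))"
      by (simp add: mult_ac)
  qed simp
  finally show ?thesis
    by (simp add: frobenius_defect_def)
qed

lemma zeval_sum: "zeval e (sum P A) = (\<Sum>x\<in>A. zeval e (P x))"
  by (induction A rule: infinite_finite_induct) (simp_all add: zeval_add)

lemma zeval_uminus: "zeval e (- P) = - zeval e P"
  using zeval_add[of e P "- P"] by (simp add: eq_neg_iff_add_eq_0 add.commute)

lemma zeval_frobenius_defect:
  "zeval e (frobenius_defect p P Q) = frobenius_defect p (zeval e P) (zeval e Q)"
  by (simp add: frobenius_defect_def zeval_uminus zeval_sum zeval_mult zeval_power zeval_of_nat)

lemma of_int_frobenius_defect: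
  "of_int (frobenius_defect p x y) = frobenius_defect p (of_int x) (of_int y)"
  by (simp add: frobenius_defect_def)

lemma ghost_0: "ghost p 0 x = x 0"
  by (simp add: ghost_def)

lemma ghost_1: "ghost p 1 x = x 0 ^ p + of_nat p * x 1"
  by (simp add: ghost_def)

lemma witt_sum_1:
  assumes "prime p"
  shows "witt_sum p 1 =
    frobenius_defect p (zvar (Inl 0)) (zvar (Inr 0)) + zvar (Inl 1) + zvar (Inr 1)"
  unfolding witt_sum_def using prime_gt_0_nat[OF assms]
proof (rule witt_solve_1)
  let ?X = "zvar (Inl 0) :: (nat + nat) zpoly" and ?Y = "zvar (Inr 0) :: (nat + nat) zpoly"
  have "ghost p 1 (zvar \<circ> Inl) + ghost p 1 (zvar \<circ> Inr)
      = (?X ^ p + ?Y ^ p) + of_nat p * (zvar (Inl 1) + zvar (Inr 1))"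
    by (simp add: ghost_1[unfolded One_nat_def] algebra_simps)
  also have "\<dots> = (ghost p 0 (zvar \<circ> Inl) + ghost p 0 (zvar \<circ> Inr)) ^ p
      + of_nat p * (frobenius_defect p ?X ?Y + zvar (Inl 1) + zvar (Inr 1))"
    unfolding frobenius_defect[OF assms] by (simp add: ghost_0 distrib_left add_ac)
  finally show "ghost p 1 (zvar \<circ> Inl) + ghost p 1 (zvar \<circ> Inr) = \<dots>" .
qed

lemma witt_product_1:
  assumes "p > 0"
  shows "witt_product p 1 = zvar (Inl 0) ^ p * zvar (Inr 1) + zvar (Inl 1) * zvar (Inr 0) ^ p
    + of_nat p * zvar (Inl 1) * zvar (Inr 1)"
  unfolding witt_product_def using assms
  by (rule witt_solve_1) (simp add: ghost_1[unfolded One_nat_def] ghost_0 power_mult_distrib algebra_simps)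

locale witt_ring =
  fixes p :: nat and wc :: "'w::idom \<Rightarrow> nat \<Rightarrow> 'k::field"
  assumes prime_p: "prime p" and char_k: "CHAR('k) = p" and witt: "witt_vectors p wc"
begin

lemma p_pos: "p > 0"
  using prime_p prime_gt_0_nat by blast

lemma bij_wc: "bij wc" and
  wc_add: "wc (x + y) m = zeval (case_sum (wc x) (wc y)) (witt_sum p m)" and
  wc_mult: "wc (x * y) m = zeval (case_sum (wc x) (wc y)) (witt_product p m)"
  using witt by (auto simp: witt_vectors_def)

lemma red_add: "witt_red wc (x + y) = witt_red wc x + witt_red wc y"
  by (simp add: witt_red_def wc_add witt_sum_0 zeval_add)

lemma red_mult: "witt_red wc (x * y) = witt_red wc x * witt_red wc y"
  by (simp add: witt_red_def wc_mult witt_product_0 zeval_mult)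

lemma red_0: "witt_red wc 0 = 0"
  using red_add[of 0 0] by (metis add_0 add_cancel_left_left)

lemma red_1: "witt_red wc 1 = 1"
proof -
  obtain x where "wc x = (\<lambda>_. 1)"
    using bij_wc by (metis bij_pointE)
  then have "witt_red wc x = 1" by (simp add: witt_red_def)
  then show ?thesis using red_mult[of x 1] by simp
qed

lemma red_of_nat: "witt_red wc (of_nat m) = of_nat m"
  by (induction m) (simp_all add: red_0 red_1 red_add)

lemma red_frob: "witt_red wc (witt_frob p wc x) = witt_red wc x ^ p"
  using bij_wc by (simp add: witt_red_def witt_frob_def bij_is_surj surj_f_inv_f)

lemma wc_1_1: "wc 1 1 = 0"
proof -
  have k: "(of_nat p :: 'k) = 0" using char_k of_nat_CHAR by metis
  have w: "wc 1 0 = 1" using red_1 by (simp add: witt_red_def)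
  have "wc (1 * 1) 1 = wc 1 1 + wc 1 1"
    unfolding wc_mult witt_product_1[OF p_pos]
    by (simp add: zeval_add zeval_mult zeval_power zeval_of_nat w k)
  then show ?thesis by (metis mult_1 add_cancel_left_left)
qed

text \<open>
  The ghost component \<open>x\<^sub>0\<^sup>p + p x\<^sub>1\<close> is additive, so the first two Witt components of a natural
  number \<open>m\<close> are the images in \<open>k\<close> of \<open>m\<close> and \<open>(m - m\<^sup>p) / p\<close>.
\<close>

lemma wc_of_nat:
  "\<exists>a. int m ^ p + int p * a = int m \<and> wc (of_nat m) 0 = of_nat m \<and> wc (of_nat m) 1 = of_int a"
proof (induction m)
  case 0
  have z: "wc 0 0 = 0" using red_0 by (simp add: witt_red_def)
  have k: "(of_nat p :: 'k) = 0" using char_k of_nat_CHAR by metis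
  have "wc (0 * 0) 1 = 0"
    unfolding wc_mult witt_product_1[OF p_pos] using p_pos
    by (simp add: zeval_add zeval_mult zeval_power zeval_of_nat z k zero_power)
  then show ?case using z p_pos by (intro exI[of _ 0]) (simp add: zero_power)
next
  case (Suc m)
  then obtain a where a: "int m ^ p + int p * a = int m" "wc (of_nat m) 0 = of_nat m"
    "wc (of_nat m) 1 = of_int a" by blast
  let ?a = "a + frobenius_defect p (int m) 1"
  have w: "wc 1 0 = 1" using red_1 by (simp add: witt_red_def)
  have "wc (of_nat m + 1) 0 = of_nat (Suc m)"
    using a(2) by (simp add: wc_add witt_sum_0 zeval_add w)
  moreover have "wc (of_nat m + 1) 1 = of_int ?a"
    using a(2,3) unfolding wc_add witt_sum_1[OF prime_p]
    by (simp add: zeval_add zeval_frobenius_defect of_int_frobenius_defect w wc_1_1[unfolded One_nat_def])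
  moreover have "int (Suc m) ^ p + int p * ?a = int (Suc m)"
    using frobenius_defect[OF prime_p, of "int m" 1] a(1) by (simp add: algebra_simps)
  ultimately show ?case by (intro exI[of _ ?a]) (simp add: add.commute)
qed

text \<open>
  The second component of \<open>p\<close> is the image of \<open>(p - p\<^sup>p) / p = 1 - p\<^bsup>p-1\<^esup>\<close>, which is \<open>1\<close>.
\<close>

lemma of_nat_p_nonzero: "(of_nat p :: 'w) \<noteq> 0"
proof
  assume z: "(of_nat p :: 'w) = 0"
  obtain a b where a: "int p ^ p + int p * a = int p" "wc (of_nat p) 1 = of_int a"
    and b: "int 0 ^ p + int p * b = int 0" "wc (of_nat 0) 1 = of_int b"
    using wc_of_nat by meson
  have "b = 0" using b(1) p_pos by (simp add: zero_power)
  then have "(of_int a :: 'k) = 0" using a(2) b(2) z by simp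
  then have d: "int p dvd a" using char_k of_int_eq_0_iff_char_dvd by metis
  have "int p * (int p ^ (p - 1) + a) = int p * 1"
    using a(1) p_pos by (simp add: distrib_left power_eq_if split: if_splits)
  then have "int p ^ (p - 1) + a = 1" using p_pos by simp
  moreover have "int p dvd int p ^ (p - 1)" using prime_gt_1_nat[OF prime_p] by (intro dvd_power) auto
  ultimately have "int p dvd 1" using d by (metis dvd_add)
  then show False using prime_gt_1_nat[OF prime_p] by simp
qed

end

section \<open>The divisibility that makes \<open>Q\<close> a polynomial\<close>

lemma bezout_mult:
  fixes g :: "'a::comm_ring_1"
  assumes "A * g + B * x = 1" "A' * g + B' * y = 1"
  shows "\<exists>A B. A * g + B * (x * y) = 1"
proof -
  have "1 = (A * g + B * x) * (A' * g + B' * y)" by (simp add: assms)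
  also have "\<dots> = (A * A' * g + A * B' * y + B * A' * x) * g + (B * B') * (x * y)"
    by (simp add: algebra_simps)
  finally show ?thesis by metis
qed

lemma bezout_power_right:
  fixes g :: "'a::comm_ring_1"
  assumes "A * g + B * x = 1"
  shows "\<exists>A B. A * g + B * x ^ m = 1"
proof (induction m)
  case (Suc m)
  then show ?case using bezout_mult[OF assms] by auto
qed (auto intro: exI[of _ 0] exI[of _ 1])

lemma bezout_powers:
  fixes g :: "'a::comm_ring_1"
  assumes "A * g + B * x = 1"
  shows "\<exists>A B. A * g ^ k + B * x ^ m = 1"
  using bezout_power_right[OF assms, of m] bezout_power_right[of _ "x ^ m" _ g k]
  by (metis add.commute)

lemma bezout_dvd:
  fixes g :: "'a::comm_ring_1"
  assumes "A * g + B * x = 1" "g dvd y * x"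
  shows "g dvd y"
proof -
  have "y = y * (A * g + B * x)" by (simp add: assms)
  also have "\<dots> = y * A * g + B * (y * x)" by (simp add: algebra_simps)
  finally show ?thesis using assms(2) by (metis dvd_add dvd_mult dvd_triv_right)
qed

lemma pderiv_power_char: "pderiv (g ^ CHAR('k)) = (0 :: 'k::idom poly)"
  by (simp add: pderiv_power)

lemma pderiv_mult_power_char: "pderiv (g * h ^ CHAR('k)) = pderiv g * (h :: 'k::idom poly) ^ CHAR('k)"
  by (simp add: pderiv_mult pderiv_power_char)

lemma of_nat_power_char:
  assumes "prime CHAR('k::comm_semiring_1)"
  shows "(of_nat m :: 'k) ^ CHAR('k) = of_nat m"
proof (induction m)
  case (Suc m)
  have "(of_nat (Suc m) :: 'k) ^ CHAR('k) = (1 + of_nat m) ^ CHAR('k)" by simp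
  also have "\<dots> = 1 + of_nat m" by (simp add: freshmans_dream[OF assms] Suc.IH)
  finally show ?case by simp
qed (use prime_gt_0_nat[OF assms] in \<open>simp add: zero_power\<close>)

lemma coeff_frob_poly: "p > 0 \<Longrightarrow> coeff (frob_poly p f) m = coeff f m ^ p"
  unfolding frob_poly_def by (rule coeff_map_poly) (simp add: zero_power)

lemma pderiv_frob_poly:
  fixes f :: "'k::idom poly"
  assumes "prime CHAR('k)"
  shows "pderiv (frob_poly CHAR('k) f) = frob_poly CHAR('k) (pderiv f)"
  using prime_gt_0_nat[OF assms] of_nat_power_char[OF assms, of "Suc _"]
  by (intro poly_eqI) (simp add: coeff_pderiv coeff_frob_poly power_mult_distrib del: of_nat_Suc)

lemma pcompose_frob_poly:
  fixes f :: "'k::idom poly"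
  assumes "prime CHAR('k)"
  shows "pcompose (frob_poly CHAR('k) f) (monom 1 CHAR('k)) = f ^ CHAR('k)"
proof (induction f)
  case (pCons a f)
  let ?p = "CHAR('k)"
  have p: "?p > 0" using assms prime_gt_0_nat by blast
  have f: "frob_poly ?p (pCons a f) = pCons (a ^ ?p) (frob_poly ?p f)"
    using p by (intro poly_eqI) (auto simp: coeff_frob_poly coeff_pCons split: nat.split)
  have "pCons a f = [:a:] + monom 1 1 * f" by (simp add: monom_altdef)
  then have "pCons a f ^ ?p = ([:a:] + monom 1 1 * f) ^ CHAR('k poly)" by simp
  also have "\<dots> = [:a:] ^ ?p + (monom 1 1 * f) ^ ?p"
    using assms by (subst freshmans_dream) auto
  also have "\<dots> = [:a ^ ?p:] + monom 1 ?p * f ^ ?p"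
    by (simp add: poly_const_pow power_mult_distrib monom_power)
  finally show ?case using pCons.IH by (simp add: f pcompose_pCons)
qed (use assms in \<open>simp add: frob_poly_def prime_gt_0_nat zero_power\<close>)

context witt_ring
begin

abbreviation red_poly :: "'w poly \<Rightarrow> 'k poly" where
  "red_poly \<equiv> map_poly (witt_red wc)"

lemma coeff_red_poly: "coeff (red_poly P) m = witt_red wc (coeff P m)"
  by (rule coeff_map_poly) (rule red_0)

lemma red_sum: "witt_red wc (sum g A) = (\<Sum>x\<in>A. witt_red wc (g x))"
  by (induction A rule: infinite_finite_induct) (simp_all add: red_0 red_add)

lemma red_uminus: "witt_red wc (- x) = - witt_red wc x"
  using red_add[of x "- x"] by (simp add: red_0 eq_neg_iff_add_eq_0 add.commute)

lemma red_poly_add: "red_poly (P + Q) = red_poly P + red_poly Q"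
  by (intro poly_eqI) (simp add: coeff_red_poly red_add)

lemma red_poly_diff: "red_poly (P - Q) = red_poly P - red_poly Q"
  using red_add[of _ "- _"] by (intro poly_eqI) (simp add: coeff_red_poly red_uminus)

lemma red_poly_mult: "red_poly (P * Q) = red_poly P * red_poly Q"
  by (intro poly_eqI) (simp add: coeff_red_poly coeff_mult red_sum red_mult)

lemma red_poly_1 [simp]: "red_poly 1 = 1"
  by (simp add: map_poly_1' red_1)

lemma red_poly_power: "red_poly (P ^ m) = red_poly P ^ m"
  by (induction m) (simp_all add: red_poly_mult)

lemma red_poly_pderiv: "red_poly (pderiv P) = pderiv (red_poly P)"
  by (intro poly_eqI) (simp add: coeff_red_poly coeff_pderiv red_mult red_of_nat del: of_nat_Suc)

lemma red_poly_monom: "red_poly (monom 1 m) = monom 1 m"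
  by (simp add: map_poly_monom red_0 red_1)

lemma red_poly_smult_p: "red_poly (smult (of_nat p) P) = 0"
  using of_nat_CHAR[where 'a='k] by (intro poly_eqI) (simp add: coeff_red_poly red_mult red_of_nat char_k)

lemma red_poly_pcompose: "red_poly (pcompose P Q) = pcompose (red_poly P) (red_poly Q)"
  by (induction P) (simp_all add: pcompose_pCons red_poly_add red_poly_mult map_poly_pCons red_0)

lemma red_poly_frob: "red_poly (map_poly (witt_frob p wc) P) = frob_poly p (red_poly P)"
proof (rule poly_eqI)
  fix m
  have "coeff (map_poly (witt_frob p wc) P) m =
      (if m \<le> degree P \<and> P \<noteq> 0 then witt_frob p wc (coeff P m) else 0)"
    by (cases "P = 0") (auto simp: map_poly_def nth_default_def coeffs_nth length_coeffs_degree)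
  then show "coeff (red_poly (map_poly (witt_frob p wc) P)) m = coeff (frob_poly p (red_poly P)) m"
    using p_pos by (auto simp: coeff_red_poly coeff_frob_poly red_frob red_0 zero_power coeff_eq_0)
qed

text \<open>
  Differentiating the congruence modulo \<open>p\<^sup>2\<close> makes the left-hand side visibly divisible by \<open>p\<close>. As the
  Witt vectors are a domain in which \<open>p \<noteq> 0\<close>, one factor \<open>p\<close> cancels, leaving a congruence modulo \<open>p\<close>,
  in which the derivatives of \<open>p\<close>-th powers vanish.
\<close>

lemma derivative_of_lift_equation:
  assumes "eq_p_times p wc (G ^ p - pcompose (map_poly (witt_frob p wc) G) (monom 1 p))
      (v * pderiv g ^ p - e * g ^ p)"
    and g: "g = red_poly G"
  shows "(monom 1 (p - 1) + pderiv v) * pderiv g ^ p = g ^ (p - 1) * pderiv g + pderiv e * g ^ p"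
proof -
  define S where "S = map_poly (witt_frob p wc) G"
  obtain L M where L: "red_poly L = v * pderiv g ^ p - e * g ^ p"
    and M: "G ^ p - pcompose S (monom 1 p) - smult (of_nat p) L = [:of_nat (p ^ 2):] * M"
    using assms(1) unfolding eq_p_times_def dvd_def S_def by blast
  define T where "T = G ^ (p - 1) * pderiv G - pcompose (pderiv S) (monom 1 p) * monom 1 (p - 1)
      - pderiv L - smult (of_nat p) (pderiv M)"
  have monom_p: "pderiv (monom 1 p) = smult (of_nat p) (monom (1 :: 'w) (p - 1))"
    by (simp add: pderiv_monom smult_monom)
  have "pderiv (G ^ p - pcompose S (monom 1 p) - smult (of_nat p) L) =
      pderiv (smult (of_nat (p ^ 2)) M)"
    by (simp only: M) simp
  then have "smult (of_nat p) (G ^ (p - 1) * pderiv G)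
      - pcompose (pderiv S) (monom 1 p) * smult (of_nat p) (monom 1 (p - 1))
      - smult (of_nat p) (pderiv L) = smult (of_nat p) (smult (of_nat p) (pderiv M))"
    by (simp add: pderiv_diff pderiv_smult pderiv_power pderiv_pcompose monom_p power2_eq_square mult.commute)
  then have "smult (of_nat p) T = 0"
    by (simp add: T_def smult_diff_right)
  then have "T = 0" using of_nat_p_nonzero by simp
  then have "red_poly T = 0" by simp
  then have "g ^ (p - 1) * pderiv g - pcompose (pderiv (frob_poly p g)) (monom 1 p) * monom 1 (p - 1)
      - pderiv (v * pderiv g ^ p - e * g ^ p) = 0"
    by (simp add: T_def red_poly_diff red_poly_mult red_poly_power red_poly_pderiv red_poly_pcompose
        red_poly_monom red_poly_smult_p L g S_def red_poly_frob)
  moreover have "pcompose (pderiv (frob_poly p g)) (monom 1 p) = pderiv g ^ p"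
    using prime_p char_k pderiv_frob_poly[of g] pcompose_frob_poly[of "pderiv g"] by simp
  moreover have "pderiv (v * pderiv g ^ p - e * g ^ p) = pderiv v * pderiv g ^ p - pderiv e * g ^ p"
    using char_k pderiv_mult_power_char[of _ "pderiv g"] pderiv_mult_power_char[of _ g]
    by (simp add: pderiv_diff)
  ultimately show ?thesis by (simp add: algebra_simps)
qed

text \<open>
  The right-hand side of the differentiated equation is divisible by \<open>g\<^bsup>p-1\<^esup>\<close>, and the factor
  \<open>g'\<^sup>p\<close> on its left-hand side is prime to \<open>g\<close>.
\<close>

lemma power_dvd_Frobenius_on_ds:
  assumes "eq_p_times p wc (G ^ p - pcompose (map_poly (witt_frob p wc) G) (monom 1 p))
      (v * pderiv g ^ p - e * g ^ p)"
    and "g = red_poly G" and cop: "A * g + B * pderiv g = 1"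
  shows "g ^ (p - 1) dvd monom 1 (p - 1) + pderiv v"
proof -
  let ?x = "monom 1 (p - 1) + pderiv v"
  have "g ^ p = g ^ (p - 1) * g" using p_pos by (simp add: power_eq_if mult.commute)
  then have "?x * pderiv g ^ p = g ^ (p - 1) * (pderiv g + pderiv e * g)"
    using derivative_of_lift_equation[OF assms(1,2)] by (simp add: algebra_simps)
  then have "g ^ (p - 1) dvd ?x * pderiv g ^ p" by simp
  then show ?thesis using bezout_powers[OF cop] bezout_dvd by metis
qed

end

section \<open>The function field\<close>

lemma ring_hom_1: "is_ring_hom h \<Longrightarrow> h 1 = 1"
  and ring_hom_add: "is_ring_hom h \<Longrightarrow> h (x + y) = h x + h y"
  and ring_hom_mult: "is_ring_hom h \<Longrightarrow> h (x * y) = h x * h y"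
  by (simp_all add: is_ring_hom_def)

lemma ring_hom_0: "is_ring_hom h \<Longrightarrow> h 0 = 0"
  using ring_hom_add[of h 0 0] by simp

lemma ring_hom_uminus: "is_ring_hom h \<Longrightarrow> h (- x) = - h x"
  using ring_hom_add[of h x "- x"] by (simp add: ring_hom_0 eq_neg_iff_add_eq_0 add.commute)

lemma ring_hom_diff: "is_ring_hom h \<Longrightarrow> h (x - y) = h x - h y"
  using ring_hom_add[of h x "- y"] by (simp add: ring_hom_uminus)

lemma ring_hom_sum: "is_ring_hom h \<Longrightarrow> h (sum g A) = (\<Sum>x\<in>A. h (g x))"
  by (induction A rule: infinite_finite_induct) (simp_all add: ring_hom_0 ring_hom_add)

lemma ring_hom_power: "is_ring_hom h \<Longrightarrow> h (x ^ m) = h x ^ m"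
  by (induction m) (simp_all add: ring_hom_1 ring_hom_mult)

lemma ring_hom_of_nat: "is_ring_hom h \<Longrightarrow> h (of_nat m) = of_nat m"
  by (induction m) (simp_all add: ring_hom_0 ring_hom_1 ring_hom_add)

lemma ring_hom_eq_0: "is_ring_hom h \<Longrightarrow> h x = 0 \<longleftrightarrow> x = 0"
  for h :: "'x::field \<Rightarrow> 'y::field"
  by (metis ring_hom_0 ring_hom_1 ring_hom_mult field_class.field_inverse mult_eq_0_iff zero_neq_one)

lemma ring_hom_inverse: "is_ring_hom h \<Longrightarrow> h (inverse x) = inverse (h x)"
  for h :: "'x::field \<Rightarrow> 'y::field"
proof (cases "x = 0")
  case False
  assume h: "is_ring_hom h"
  have "h (inverse x) * h x = 1" using h False by (metis ring_hom_1 ring_hom_mult field_class.field_inverse)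
  then show ?thesis by (metis inverse_unique mult.commute)
qed (simp add: ring_hom_0)

lemma ring_hom_divide: "is_ring_hom h \<Longrightarrow> h (x / y) = h x / h y"
  for h :: "'x::field \<Rightarrow> 'y::field"
  by (simp add: divide_inverse ring_hom_mult ring_hom_inverse)

lemmas ring_homs = ring_hom_0 ring_hom_1 ring_hom_add ring_hom_mult ring_hom_uminus ring_hom_diff
  ring_hom_sum ring_hom_power ring_hom_of_nat

lemma ring_hom_poly_map:
  fixes h :: "'x::comm_ring_1 \<Rightarrow> 'y::comm_ring_1"
  assumes h: "is_ring_hom h"
  shows "is_ring_hom (\<lambda>q. poly (map_poly h q) x)"
proof -
  have add: "map_poly h (p + q) = map_poly h p + map_poly h q" for p q
    by (intro poly_eqI) (simp add: coeff_map_poly ring_homs[OF h])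
  have mult: "map_poly h (p * q) = map_poly h p * map_poly h q" for p q
    by (intro poly_eqI) (simp add: coeff_map_poly coeff_mult ring_homs[OF h])
  show ?thesis
    by (simp add: is_ring_hom_def add mult map_poly_1' ring_homs[OF h])
qed

text \<open>
  Applied to \<open>h = ev2 C t y\<close>, this gives the ring structure of \<open>OU C\<close> (with \<open>u = y\<close>) and of \<open>OUV C\<close>
  (with \<open>u = t y\<close>).
\<close>

lemma fractions_closed:
  fixes h :: "'x::comm_ring_1 \<Rightarrow> 'y::field"
  assumes h: "is_ring_hom h" and u: "h u \<noteq> 0"
    and A: "A = {h P / h u ^ m |P m. True}"
  shows "x \<in> A \<Longrightarrow> y \<in> A \<Longrightarrow> x + y \<in> A" "x \<in> A \<Longrightarrow> y \<in> A \<Longrightarrow> x * y \<in> A"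
    and "h P \<in> A" "inverse (h u) \<in> A"
proof -
  assume "x \<in> A" "y \<in> A"
  then obtain P m Q k where x: "x = h P / h u ^ m" and y: "y = h Q / h u ^ k" by (auto simp: A)
  have "x + y = h (P * u ^ k + Q * u ^ m) / h u ^ (m + k)"
    using u by (simp add: x y ring_homs[OF h] field_simps power_add)
  then show "x + y \<in> A" unfolding A by blast
  have "x * y = h (P * Q) / h u ^ (m + k)"
    using u by (simp add: x y ring_homs[OF h] field_simps power_add)
  then show "x * y \<in> A" unfolding A by blast
next
  have "h P = h P / h u ^ 0" by simp
  then show "h P \<in> A" unfolding A by blast
  have "inverse (h u) = h 1 / h u ^ 1" by (simp add: ring_homs[OF h] field_simps)
  then show "inverse (h u) \<in> A" unfolding A by blast
qed

lemma coset_eq_iff: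
  assumes "0 \<in> B" and diff: "\<And>x y. x \<in> B \<Longrightarrow> y \<in> B \<Longrightarrow> x - y \<in> B"
  shows "coset B x = coset B y \<longleftrightarrow> x - y \<in> B"
proof
  assume "coset B x = coset B y"
  moreover have "x \<in> coset B x" using assms(1) by (simp add: coset_def)
  ultimately show "x - y \<in> B" by (simp add: coset_def)
next
  assume xy: "x - y \<in> B"
  have neg: "- w \<in> B" if "w \<in> B" for w using diff[OF assms(1) that] by simp
  have "w - x \<in> B \<longleftrightarrow> w - y \<in> B" for w
    using diff[of "w - x" "- (x - y)"] diff[of "w - y" "x - y"] xy neg[of "x - y"]
    by (auto simp: algebra_simps)
  then show "coset B x = coset B y" by (simp add: coset_def)
qed

locale superelliptic_field =
  fixes n :: nat and f :: "'k::field poly" and C :: "('k, 'a::field) ffield"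
  assumes ff: "function_field n f C" and n2: "n \<ge> 2"
begin

abbreviation "e \<equiv> emb C"
abbreviation "t \<equiv> tt C"
abbreviation "y \<equiv> yy C"
abbreviation "s \<equiv> ss C"
abbreviation "D \<equiv> der C"

lemma hom_e: "is_ring_hom e"
  using ff by (simp add: function_field_def)

lemma hom_ev: "is_ring_hom (ev C x)"
  unfolding ev_def[abs_def] by (rule ring_hom_poly_map[OF hom_e])

lemma hom_ev2: "is_ring_hom (ev2 C x w)"
  unfolding ev2_def[abs_def] by (rule ring_hom_poly_map[OF hom_ev])

lemmas e_simps = ring_homs[OF hom_e] ring_hom_divide[OF hom_e]
lemmas ev_simps = ring_homs[OF hom_ev]
lemmas ev2_simps = ring_homs[OF hom_ev2]

lemmas e_0 [simp] = ring_hom_0[OF hom_e] and e_1 [simp] = ring_hom_1[OF hom_e]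

lemma e_eq_0 [simp]: "e x = 0 \<longleftrightarrow> x = 0"
  by (rule ring_hom_eq_0[OF hom_e])

lemma ev_pCons: "ev C x (pCons a q) = e a + x * ev C x q"
  by (simp add: ev_def map_poly_pCons e_simps)

lemma ev_const: "ev C x [:a:] = e a"
  by (simp add: ev_pCons ev_simps)

lemma ev_monom: "ev C x (monom a m) = e a * x ^ m"
  by (simp add: ev_def map_poly_monom e_simps poly_monom)

lemma ev_smult: "ev C x (smult a q) = e a * ev C x q"
  using ring_hom_mult[OF hom_ev, of x "[:a:]" q] by (simp add: ev_const)

lemma ev_eq_sum: "degree q \<le> N \<Longrightarrow> ev C x q = (\<Sum>m\<le>N. e (coeff q m) * x ^ m)"
  by (subst poly_as_sum_of_monoms'[symmetric, of q N]) (simp_all add: ev_simps ev_monom)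

lemma ev2_const: "ev2 C x w [:q:] = ev C x q"
  by (simp add: ev2_def map_poly_pCons ev_simps)

lemma ev2_var: "ev2 C x w [:0, 1:] = w"
  by (simp add: ev2_def map_poly_pCons ev_simps)

lemma ev2_monom: "ev2 C x w (monom q m) = ev C x q * w ^ m"
  by (simp add: ev2_def map_poly_monom ev_simps poly_monom)

lemma ev2_eq_0_iff: "ev2 C t y P = 0 \<longleftrightarrow> (monom 1 n - [:f:]) dvd P"
  using ff by (simp add: function_field_def)

lemma degree_relation: "degree (monom 1 n - [:f:]) = n"
  using n2 by (intro antisym degree_le le_degree) (auto simp: coeff_pCons split: nat.split)

lemma ev2_eq_0_imp: "degree P < n \<Longrightarrow> ev2 C t y P = 0 \<Longrightarrow> P = 0"
  using dvd_imp_degree_le[of "monom 1 n - [:f:]" P] by (auto simp: ev2_eq_0_iff degree_relation)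

lemma y_power_n: "y ^ n = ev C t f"
  using ev2_eq_0_iff[of "monom 1 n - [:f:]"] by (simp add: ev2_simps ev2_monom ev2_const ev_simps)

text \<open>
  Linear independence of the powers of \<open>y\<close> below the \<open>n\<close>-th over \<open>k(t)\<close>: a relation is a
  polynomial in \<open>y\<close> of degree less than \<open>n\<close> divisible by the monic \<open>y\<^sup>n - f\<close>.
\<close>

lemma y_powers_independent:
  assumes "(\<Sum>j<n. ev C t (A j) * y ^ j) = 0" "j < n"
  shows "A j = 0"
proof -
  let ?P = "\<Sum>j<n. monom (A j) j"
  have c: "coeff ?P m = (if m < n then A m else 0)" for m
    by (simp add: coeff_sum coeff_monom if_distrib cong: if_cong)
  have "degree ?P < n" using n2 by (intro le_less_trans[OF degree_le[of "n - 1"]]) (auto simp: c)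
  moreover have "ev2 C t y ?P = 0" using assms(1) by (simp add: ev2_simps ev2_monom)
  ultimately have "?P = 0" by (rule ev2_eq_0_imp)
  then show ?thesis using c[of j] assms(2) by simp
qed

lemma ev_t_eq_0 [simp]: "ev C t q = 0 \<longleftrightarrow> q = 0"
proof
  assume "ev C t q = 0"
  then have "(\<Sum>j<n. ev C t (if j = 0 then q else 0) * y ^ j) = 0"
    by (intro sum.neutral) (auto simp: ev_simps)
  from y_powers_independent[OF this, of 0] show "q = 0" using n2 by simp
qed (simp add: ev_simps)

lemma ev_t_eq_iff: "ev C t q = ev C t q' \<longleftrightarrow> q = q'"
  using ev_t_eq_0[of "q - q'"] by (simp add: ev_simps)

lemma t_nonzero [simp]: "t \<noteq> 0"
  using ev_t_eq_0[of "monom 1 1"] by (auto simp: ev_monom)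

lemma s_nonzero [simp]: "s \<noteq> 0" and st [simp]: "s * t = 1" "t * s = 1"
  by (simp_all add: ss_def)

lemma y_nonzero [simp]: "y \<noteq> 0"
proof
  assume "y = 0"
  then have "ev2 C t y [:0, 1:] = 0" by (simp add: ev2_var)
  then have "[:0, 1:] = (0 :: 'k poly poly)" using n2 by (intro ev2_eq_0_imp) auto
  then show False by simp
qed

lemma f_nonzero [simp]: "f \<noteq> 0"
  using y_power_n y_nonzero by (metis power_not_zero ev_t_eq_0)

lemma t_power_s_power: "j \<le> i \<Longrightarrow> t ^ i * s ^ j = t ^ (i - j)" "i \<le> j \<Longrightarrow> t ^ i * s ^ j = s ^ (j - i)"
  by (simp_all add: ss_def power_diff field_simps)

lemma D_add: "D (g + h) = D g + D h" and D_mult: "D (g * h) = g * D h + h * D g"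
  and D_e: "D (e x) = 0" and D_t: "D t = 1"
  using ff by (simp_all add: function_field_def)

lemma D_0: "D 0 = 0" using D_mult[of 0 0] by simp
lemma D_1: "D 1 = 0" using D_e[of 1] by (simp add: e_simps)
lemma D_uminus: "D (- g) = - D g"
  using D_add[of g "- g"] by (simp add: D_0 eq_neg_iff_add_eq_0 add.commute)
lemma D_diff: "D (g - h) = D g - D h"
  using D_add[of g "- h"] by (simp add: D_uminus)
lemma D_sum: "D (sum g A) = (\<Sum>x\<in>A. D (g x))"
  by (induction A rule: infinite_finite_induct) (simp_all add: D_0 D_add)
lemma D_e_mult: "D (e x * g) = e x * D g"
  by (simp add: D_mult D_e)

lemma D_power: "D (g ^ m) = of_nat m * g ^ (m - 1) * D g"
proof (induction m)
  case (Suc m)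
  then show ?case by (cases m) (simp_all add: D_mult algebra_simps D_1)
qed (simp add: D_1)

lemma D_ev: "D (ev C x q) = ev C x (pderiv q) * D x"
  by (induction q)
    (simp_all add: ev_pCons ev_simps D_0 D_add D_mult D_e pderiv_pCons algebra_simps)

lemma D_inverse: "g \<noteq> 0 \<Longrightarrow> D (inverse g) = - D g / g ^ 2"
proof -
  assume g: "g \<noteq> 0"
  have "D (g * inverse g) = 0" using g by (simp add: D_1)
  then have "g * D (inverse g) = - (inverse g * D g)" by (simp add: D_mult eq_neg_iff_add_eq_0)
  then show ?thesis using g by (simp add: field_simps power2_eq_square)
qed

lemma D_s: "D s = - (s ^ 2)"
  using D_inverse[of t] by (simp add: ss_def D_t power_inverse divide_inverse)

lemma D_y: "of_nat n * y ^ (n - 1) * D y = ev C t (pderiv f)"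
  using arg_cong[OF y_power_n, of D] by (simp add: D_power D_ev D_t)

text \<open>
  The polynomial \<open>x\<^sup>N q(1/x)\<close>, used to pass between \<open>s\<close> and \<open>t\<close>. For \<open>N < deg q\<close> it is the polynomial
  part of that Laurent polynomial.
\<close>

definition reversed :: "nat \<Rightarrow> 'k poly \<Rightarrow> 'k poly" where
  "reversed N q = (\<Sum>m\<le>N. monom (coeff q m) (N - m))"

lemma ev_reversed:
  assumes "degree q \<le> N" "x \<noteq> 0"
  shows "ev C x (reversed N q) = x ^ N * ev C (inverse x) q"
proof -
  have "x ^ (N - m) = x ^ N * inverse x ^ m" if "m \<le> N" for m
    using assms(2) that by (simp add: power_diff power_inverse divide_inverse)
  then show ?thesis
    unfolding reversed_def ev_eq_sum[OF assms(1)] by (simp add: ev_simps ev_monom sum_distrib_left mult_ac)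
qed

lemma coeff_reversed: "m \<le> N \<Longrightarrow> coeff (reversed N q) m = coeff q (N - m)"
proof -
  assume m: "m \<le> N"
  have "coeff (reversed N q) m = (\<Sum>k\<le>N. if k = N - m then coeff q k else 0)"
    unfolding reversed_def coeff_sum using m by (intro sum.cong) (auto simp: coeff_monom)
  then show ?thesis using m by simp
qed

lemma ev_s_eq_0 [simp]: "ev C s q = 0 \<longleftrightarrow> q = 0"
proof
  assume "ev C s q = 0"
  then have "ev C t (reversed (degree q) q) = 0" by (simp add: ev_reversed ss_def)
  then have "reversed (degree q) q = 0" by simp
  then have "lead_coeff q = 0" using coeff_reversed[of 0 "degree q" q] by simp
  then show "q = 0" by simp
qed (simp add: ev_simps)

lemma ev_s_eq_iff: "ev C s q = ev C s q' \<longleftrightarrow> q = q'"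
  using ev_s_eq_0[of "q - q'"] by (simp add: ev_simps)

text \<open>
  An element of \<open>k[s]\<close> that lies in \<open>k[t, 1/f]\<close> is constant, as \<open>t = 0\<close> would otherwise be a pole. All
  comparisons of the two charts come down to this.
\<close>

lemma constant_of_regular_at_0:
  assumes "poly f 0 \<noteq> 0" "ev C s q * ev C t f ^ M = ev C t g" "m > 0"
  shows "coeff q m = 0"
proof -
  have "degree q = 0"
  proof (rule ccontr)
    let ?N = "degree q"
    assume N: "?N \<noteq> 0"
    have "ev C t (reversed ?N q * f ^ M) = ev C t (monom 1 ?N * g)"
      using assms(2) by (simp add: ev_simps ev_reversed ev_monom ss_def mult.assoc)
    then have "reversed ?N q * f ^ M = monom 1 ?N * g" by (simp add: ev_t_eq_iff)
    then have "coeff (reversed ?N q * f ^ M) 0 = 0" using N by (simp add: coeff_mult)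
    then have "lead_coeff q * poly f 0 ^ M = 0"
      by (simp add: coeff_mult coeff_reversed coeff_0_power poly_0_coeff_0)
    then show False using assms(1) N by auto
  qed
  then show ?thesis using assms(3) by (intro coeff_eq_0) simp
qed

text \<open>
  The relation \<open>w\<^sup>n = g(x)\<close> reduces powers of \<open>w\<close>. It is used for \<open>(t, y)\<close> and for \<open>(s, z)\<close>.
\<close>

lemma ev2_normal_form:
  assumes w: "w ^ n = ev C x g"
  shows "\<exists>A. ev2 C x w P = (\<Sum>j<n. ev C x (A j) * w ^ j)"
proof (induction P)
  case 0
  show ?case by (intro exI[of _ "\<lambda>_. 0"]) (simp add: ev2_simps ev_simps)
next
  case (pCons q P)
  then obtain A where A: "ev2 C x w P = (\<Sum>j<n. ev C x (A j) * w ^ j)" by blast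
  obtain k where k: "n = Suc k" using n2 by (cases n) auto
  define B where "B j = (if j = 0 then q + g * A k else A (j - 1))" for j
  have "pCons q P = [:q:] + [:0, 1:] * P" by simp
  then have "ev2 C x w (pCons q P) = ev C x q + w * ev2 C x w P"
    by (simp add: ev2_simps ev2_const ev2_var del: mult_pCons_left)
  also have "w * ev2 C x w P = (\<Sum>j<k. ev C x (A j) * w ^ Suc j) + ev C x (A k) * w ^ n"
    by (simp add: A k distrib_left sum_distrib_left mult_ac)
  also have "ev C x q + \<dots> = ev C x (B 0) * w ^ 0 + (\<Sum>j<k. ev C x (B (Suc j)) * w ^ Suc j)"
    by (simp add: B_def w ev_simps mult_ac)
  also have "\<dots> = (\<Sum>j<n. ev C x (B j) * w ^ j)" unfolding k by (rule sum.lessThan_Suc_shift[symmetric])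
  finally show ?case by blast
qed

lemma OU_eq: "OU C = {ev2 C t y P / ev2 C t y [:0, 1:] ^ m |P m. True}"
  by (simp add: OU_def ev2_var)

lemma OUV_eq: "OUV C = {ev2 C t y P / ev2 C t y (monom (monom 1 1) 1) ^ m |P m. True}"
  by (simp add: OUV_def ev2_monom ev_monom e_simps)

lemma OU_add: "g \<in> OU C \<Longrightarrow> h \<in> OU C \<Longrightarrow> g + h \<in> OU C"
  and OU_mult: "g \<in> OU C \<Longrightarrow> h \<in> OU C \<Longrightarrow> g * h \<in> OU C"
  and OU_ev2: "ev2 C t y P \<in> OU C" and OU_inverse_y: "inverse y \<in> OU C"
  using fractions_closed[OF hom_ev2 _ OU_eq] by (simp_all add: ev2_var)

lemma OUV_add: "g \<in> OUV C \<Longrightarrow> h \<in> OUV C \<Longrightarrow> g + h \<in> OUV C"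
  and OUV_mult: "g \<in> OUV C \<Longrightarrow> h \<in> OUV C \<Longrightarrow> g * h \<in> OUV C"
  and OUV_ev2: "ev2 C t y P \<in> OUV C" and OUV_inverse_ty: "inverse (t * y) \<in> OUV C"
  using fractions_closed[OF hom_ev2 _ OUV_eq] by (simp_all add: ev2_monom ev_monom e_simps)

lemma OU_ev: "ev C t q \<in> OU C" and OU_y: "y \<in> OU C" and OU_e: "e a \<in> OU C"
  using OU_ev2[of "[:q:]"] OU_ev2[of "[:0, 1:]"] OU_ev2[of "[:[:a:]:]"]
  by (simp_all add: ev2_const ev2_var ev_const)

lemma OU_power: "g \<in> OU C \<Longrightarrow> g ^ m \<in> OU C"
  by (induction m) (use OU_e[of 1] in \<open>simp_all add: OU_mult e_simps\<close>)

lemma OU_uminus: "g \<in> OU C \<Longrightarrow> - g \<in> OU C"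
  using OU_mult[OF OU_e[of "-1"]] by (simp add: e_simps)

lemma OU_sum: "(\<And>x. x \<in> A \<Longrightarrow> g x \<in> OU C) \<Longrightarrow> sum g A \<in> OU C"
  by (induction A rule: infinite_finite_induct) (use OU_e[of 0] in \<open>simp_all add: OU_add e_simps\<close>)

lemma OU_inverse_f: "inverse (ev C t f) \<in> OU C"
  using OU_power[OF OU_inverse_y, of n] by (simp add: y_power_n power_inverse)

lemma OUV_e: "e a \<in> OUV C" and OUV_y: "y \<in> OUV C" and OUV_t: "t \<in> OUV C"
  using OUV_ev2[of "[:[:a:]:]"] OUV_ev2[of "[:0, 1:]"] OUV_ev2[of "[:monom 1 1:]"]
  by (simp_all add: ev2_const ev2_var ev_const ev_monom e_simps)

lemma OUV_s: "s \<in> OUV C"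
  using OUV_mult[OF OUV_y OUV_inverse_ty] by (simp add: ss_def field_simps)

lemma OUV_power: "g \<in> OUV C \<Longrightarrow> g ^ m \<in> OUV C"
  by (induction m) (use OUV_e[of 1] in \<open>simp_all add: OUV_mult e_simps\<close>)

lemma OUV_sum: "(\<And>x. x \<in> A \<Longrightarrow> g x \<in> OUV C) \<Longrightarrow> sum g A \<in> OUV C"
  by (induction A rule: infinite_finite_induct) (use OUV_e[of 0] in \<open>simp_all add: OUV_add e_simps\<close>)

text \<open>
  Denominators can be taken to be powers of \<open>f\<close>, as \<open>1 / y = y\<^bsup>n-1\<^esup> / f\<close>.
\<close>

lemma OU_normal_form:
  assumes "g \<in> OU C"
  obtains A M where "g * ev C t f ^ M = (\<Sum>j<n. ev C t (A j) * y ^ j)"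
proof -
  obtain P m where g: "g = ev2 C t y P / y ^ m" using assms by (auto simp: OU_def)
  obtain A where A: "ev2 C t y (P * monom 1 (n * m - m)) = (\<Sum>j<n. ev C t (A j) * y ^ j)"
    using ev2_normal_form[OF y_power_n] by blast
  have "ev C t f ^ m = y ^ (n * m - m) * y ^ m"
    using n2 by (simp flip: y_power_n power_mult power_add)
  then have "g * ev C t f ^ m = ev2 C t y (P * monom 1 (n * m - m))"
    by (simp add: g ev2_simps ev2_monom ev_simps)
  with A that show ?thesis by simp
qed

lemma OUV_normal_form:
  assumes "g \<in> OUV C"
  obtains A M where "g * (t ^ M * ev C t f ^ M) = (\<Sum>j<n. ev C t (A j) * y ^ j)"
proof -
  obtain P m where g: "g = ev2 C t y P / (t * y) ^ m" using assms by (auto simp: OUV_def)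
  obtain A where A: "ev2 C t y (P * monom 1 (n * m - m)) = (\<Sum>j<n. ev C t (A j) * y ^ j)"
    using ev2_normal_form[OF y_power_n] by blast
  have "ev C t f ^ m = y ^ (n * m - m) * y ^ m"
    using n2 by (simp flip: y_power_n power_mult power_add)
  then have "g * (t ^ m * ev C t f ^ m) = ev2 C t y (P * monom 1 (n * m - m))"
    by (simp add: g ev2_simps ev2_monom ev_simps power_mult_distrib)
  with A that show ?thesis by simp
qed

text \<open>
  The eigencomponents, for the action of the \<open>n\<close>-th roots of unity on \<open>y\<close>, of a function on
  \<open>U \<inter> D(y)\<close> are again regular there, so those that are polynomials in \<open>s\<close> are constants.
\<close>

lemma constants_of_OU:
  assumes f0: "poly f 0 \<noteq> 0" and g: "(\<Sum>j<n. ev C s (E j) * y ^ j) \<in> OU C"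
    and "j < n" "m > 0"
  shows "coeff (E j) m = 0"
proof -
  obtain A M where A: "(\<Sum>j<n. ev C s (E j) * y ^ j) * ev C t f ^ M = (\<Sum>j<n. ev C t (A j) * y ^ j)"
    using OU_normal_form[OF g] by blast
  define N where "N = Max ((\<lambda>j. degree (E j)) ` {..<n})"
  have N: "degree (E j) \<le> N" if "j < n" for j using that by (simp add: N_def)
  have "(\<Sum>j<n. ev C t (reversed N (E j) * f ^ M - monom 1 N * A j) * y ^ j) =
      (\<Sum>j<n. t ^ N * (ev C s (E j) * y ^ j * ev C t f ^ M - ev C t (A j) * y ^ j))"
    by (intro sum.cong) (simp_all add: ev_simps ev_reversed[OF N] ev_monom ss_def algebra_simps)
  also have "\<dots> = 0"
    using A by (simp add: sum_subtractf sum_distrib_right flip: sum_distrib_left)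
  finally have "reversed N (E j) * f ^ M - monom 1 N * A j = 0"
    by (rule y_powers_independent) (rule \<open>j < n\<close>)
  then have "ev C t (reversed N (E j) * f ^ M - monom 1 N * A j) = 0" by (simp only: ev_t_eq_0)
  then have "ev C s (E j) * ev C t f ^ M = ev C t (A j)"
    using \<open>j < n\<close> by (simp add: ev_simps ev_reversed[OF N] ev_monom ss_def mult.assoc)
  then show ?thesis by (rule constant_of_regular_at_0[OF f0 _ \<open>m > 0\<close>])
qed

end

section \<open>The curve on the chart at infinity\<close>

lemma Omega_single: "g \<in> A \<Longrightarrow> h \<in> A \<Longrightarrow> g * der C h \<in> Omega C A"
  unfolding Omega_def by (rule CollectI) (intro exI[of _ 1] exI[of _ "\<lambda>_. g"] exI[of _ "\<lambda>_. h"]; simp)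

lemma Omega_two:
  assumes "g \<in> A" "h \<in> A" "g' \<in> A" "h' \<in> A"
  shows "g * der C h + g' * der C h' \<in> Omega C A"
proof -
  let ?g = "\<lambda>q::nat. if q = 0 then g else g'" and ?h = "\<lambda>q::nat. if q = 0 then h else h'"
  have "g * der C h + g' * der C h' = (\<Sum>q<2. ?g q * der C (?h q))"
    by (simp add: numeral_2_eq_2)
  moreover have "\<forall>q<2. ?g q \<in> A \<and> ?h q \<in> A" using assms by auto
  ultimately show ?thesis
    unfolding Omega_def by (intro CollectI exI[of _ 2] exI[of _ ?g] exI[of _ ?h] conjI)
qed

lemma h_index_eq: "h_index n r = (\<lambda>(j, i). (i, j)) ` (SIGMA j:{1..<n}. {1..<r * j})"
  by (auto simp: h_index_def image_iff)

lemma finite_h_index: "finite (h_index n r)"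
  by (simp add: h_index_eq)

lemma sum_h_index: "(\<Sum>x\<in>h_index n r. g x) = (\<Sum>j\<in>{1..<n}. \<Sum>i\<in>{1..<r * j}. g (i, j))"
  unfolding h_index_eq by (subst sum.reindex) (auto simp: inj_on_def sum.Sigma split_def)

lemma sum_triple: "finite A \<Longrightarrow> (\<Sum>x\<in>A. (a x, - b x, c x)) = (sum a A, - sum b A, sum c A)"
  for a b c :: "'x \<Rightarrow> 'y::ab_group_add"
  by (induction rule: finite_induct) (simp_all add: zero_prod_def)

locale superelliptic_curve = superelliptic_field n f C
  for n :: nat and f :: "'k::field poly" and C :: "('k, 'a::field) ffield" +
  fixes r :: nat
  assumes f0: "poly f 0 \<noteq> 0" and degree_f: "n * r = degree f + 1" and n_unit: "of_nat n \<noteq> (0 :: 'k)"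
begin

abbreviation "z \<equiv> zz r C"
abbreviation "f2 \<equiv> poly_at_infinity (degree f) f"

lemma r_pos: "r > 0"
  using degree_f by (cases r) auto

lemma z_nonzero [simp]: "z \<noteq> 0"
  by (simp add: zz_def)

lemma n_nonzero [simp]: "of_nat n \<noteq> (0 :: 'a)"
  using n_unit by (simp flip: ring_hom_of_nat[OF hom_e])

lemma f2_eq: "f2 = monom 1 1 * reversed (degree f) f"
  unfolding poly_at_infinity_def reversed_def sum_distrib_left
  by (intro sum.cong) (auto simp: mult_monom Suc_diff_le)

lemma ev_s_f2: "ev C s f2 = s ^ (degree f + 1) * ev C t f"
  by (simp add: f2_eq ev_simps ev_monom ev_reversed) (simp add: ss_def)

lemma z_power_n: "z ^ n = ev C s f2"
  using degree_f by (simp add: zz_def power_mult_distrib ev_s_f2 y_power_n mult.commute flip: power_mult)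

lemma OV_add: "g \<in> OV r C \<Longrightarrow> h \<in> OV r C \<Longrightarrow> g + h \<in> OV r C"
  and OV_mult: "g \<in> OV r C \<Longrightarrow> h \<in> OV r C \<Longrightarrow> g * h \<in> OV r C"
  unfolding OV_def by (auto simp flip: ring_hom_add[OF hom_ev2] ring_hom_mult[OF hom_ev2])

lemma OV_ev: "ev C s q \<in> OV r C" and OV_z: "z \<in> OV r C" and OV_e: "e a \<in> OV r C"
  using rangeI[of "ev2 C s z" "[:q:]"] rangeI[of "ev2 C s z" "[:0, 1:]"]
    rangeI[of "ev2 C s z" "[:[:a:]:]"]
  by (simp_all add: OV_def ev2_const ev2_var ev_const)

lemma OV_s: "s \<in> OV r C"
  using OV_ev[of "monom 1 1"] by (simp add: ev_monom)

lemma OV_power: "g \<in> OV r C \<Longrightarrow> g ^ m \<in> OV r C"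
  by (induction m) (use OV_e[of 1] in \<open>simp_all add: OV_mult\<close>)

lemma OV_uminus: "g \<in> OV r C \<Longrightarrow> - g \<in> OV r C"
  using OV_mult[OF OV_e[of "-1"]] by (simp add: e_simps)

lemma OV_sum: "(\<And>x. x \<in> A \<Longrightarrow> g x \<in> OV r C) \<Longrightarrow> sum g A \<in> OV r C"
  by (induction A rule: infinite_finite_induct) (use OV_e[of 0] in \<open>simp_all add: OV_add\<close>)

lemma OV_monomial: "r * j \<le> m \<Longrightarrow> s ^ m * y ^ j \<in> OV r C"
proof -
  assume "r * j \<le> m"
  then have "s ^ m * y ^ j = s ^ (m - r * j) * z ^ j"
    by (simp add: zz_def power_mult_distrib flip: power_mult power_add mult.assoc)
  then show ?thesis by (simp add: OV_mult OV_power OV_s OV_z)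
qed

lemma OV_normal_form:
  assumes "g \<in> OV r C"
  obtains B where "g = (\<Sum>j<n. ev C s (B j * monom 1 (r * j)) * y ^ j)"
proof -
  obtain P where "g = ev2 C s z P" using assms by (auto simp: OV_def)
  moreover obtain B where "ev2 C s z P = (\<Sum>j<n. ev C s (B j) * z ^ j)"
    using ev2_normal_form[OF z_power_n] by blast
  moreover have "ev C s (B j) * z ^ j = ev C s (B j * monom 1 (r * j)) * y ^ j" for j
    by (simp add: zz_def power_mult_distrib ev_simps ev_monom flip: power_mult)
  ultimately show ?thesis using that by simp
qed

text \<open>
  Smoothness on \<open>V\<close>: the identity \<open>A f + B f' = 1\<close> in \<open>t\<close>, multiplied by a power of \<open>s\<close>, puts that
  power in the ideal of \<open>f2\<close> and \<open>f2'\<close>. As \<open>deg f = n r - 1\<close> exactly, \<open>s = 0\<close> is a simple root of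
  \<open>f2\<close>, so \<open>s\<close> is prime to \<open>f2'\<close>.
\<close>

lemma bezout_f2:
  assumes "A * f + B * pderiv f = 1"
  shows "\<exists>A B. A * f2 + B * pderiv f2 = 1"
proof -
  let ?l = "degree f"
  define M where "M = degree A + degree B"
  have Ds: "D (s ^ (?l + 1)) = - (of_nat (?l + 1) * s ^ (?l + 2))"
    using D_power[of s "?l + 1"] by (simp add: D_s power2_eq_square mult_ac)
  have "ev C s (pderiv f2) * D s = D (s ^ (?l + 1) * ev C t f)"
    by (simp only: D_ev flip: ev_s_f2)
  also have "\<dots> = s ^ (?l + 1) * ev C t (pderiv f) - of_nat (?l + 1) * s ^ (?l + 2) * ev C t f"
    unfolding D_mult D_ev D_t Ds by (simp add: algebra_simps)
  finally have "s ^ (?l + 1) * ev C t (pderiv f) =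
      ev C s (smult (of_nat (?l + 1)) (monom 1 1 * f2) - monom 1 2 * pderiv f2)"
    by (simp add: D_s ev_simps ev_smult ev_monom ev_s_f2 e_simps algebra_simps)
  moreover have "s ^ M * ev C t A = ev C s (reversed M A)" "s ^ M * ev C t B = ev C s (reversed M B)"
    using ev_reversed[of A M s] ev_reversed[of B M s] by (simp_all add: M_def ss_def)
  moreover have "s ^ (?l + 1 + M) =
      (s ^ M * ev C t A) * (s ^ (?l + 1) * ev C t f) + (s ^ M * ev C t B) * (s ^ (?l + 1) * ev C t (pderiv f))"
  proof -
    have "(s ^ M * ev C t A) * (s ^ (?l + 1) * ev C t f) + (s ^ M * ev C t B) * (s ^ (?l + 1) * ev C t (pderiv f))
      = s ^ (?l + 1 + M) * ev C t (A * f + B * pderiv f)"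
      unfolding ev_simps power_add by (simp only: algebra_simps)
    then show ?thesis by (simp add: assms ev_simps)
  qed
  ultimately have "ev C s (monom 1 (?l + 1 + M)) = ev C s (reversed M A * f2 +
      reversed M B * (smult (of_nat (?l + 1)) (monom 1 1 * f2) - monom 1 2 * pderiv f2))"
    by (simp only: ev_simps ev_monom ev_s_f2 e_1 mult_1)
  then have N: "monom 1 (?l + 1 + M) = reversed M A * f2 +
      reversed M B * (smult (of_nat (?l + 1)) (monom 1 1 * f2) - monom 1 2 * pderiv f2)"
    by (simp only: ev_s_eq_iff)
  define u where "u = coeff (pderiv f2) 0"
  have "u = lead_coeff f"
    by (simp add: u_def coeff_pderiv f2_eq coeff_monom_mult coeff_reversed)
  then have u: "u \<noteq> 0" by simp
  obtain w where "pderiv f2 = pCons u w"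
    by (metis u_def coeff_pCons_0 pCons_cases)
  then have w: "pderiv f2 = [:u:] + monom 1 1 * w" by (simp add: monom_altdef)
  have "smult (inverse u) 1 * pderiv f2 + (- smult (inverse u) w) * monom 1 1 = 1"
    unfolding w using u by (simp add: algebra_simps one_pCons)
  then obtain A' B' where "A' * pderiv f2 + B' * monom 1 1 ^ (?l + 1 + M) = 1"
    using bezout_power_right by blast
  then have "A' * pderiv f2 + B' * monom 1 (?l + 1 + M) = 1"
    unfolding monom_power by simp
  then have "(B' * (reversed M A + reversed M B * smult (of_nat (?l + 1)) (monom 1 1))) * f2
      + (A' - B' * reversed M B * monom 1 2) * pderiv f2 = 1"
    unfolding N by (simp add: algebra_simps)
  then show ?thesis by blast
qed

lemma D_z: "of_nat n * z ^ (n - 1) * D z = ev C s (pderiv f2) * D s"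
  using arg_cong[OF z_power_n, of D] by (simp add: D_power D_ev)

text \<open>
  On \<open>V\<close> such a form is a polynomial in \<open>s\<close> times \<open>z\<^bsup>-b\<^esup> ds\<close>. With \<open>A f2 + B f2' = 1\<close> and
  \<open>n z\<^bsup>n-1\<^esup> dz = f2' ds\<close>, one has \<open>z\<^bsup>-b\<^esup> ds = A z\<^bsup>n-b\<^esup> ds + n B z\<^bsup>n-1-b\<^esup> dz\<close>, which is regular for
  \<open>1 \<le> b \<le> n - 1\<close>.
\<close>

lemma form_in_H0:
  assumes bez: "A * f + B * pderiv f = 1" and b: "1 \<le> b" "b + 1 \<le> n"
  shows "(\<Sum>\<mu> | \<mu> + 2 \<le> r * b. e (c \<mu>) * (t ^ \<mu> / y ^ b)) \<in> H0 r C" (is "?w \<in> _")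
proof -
  have "?w = (\<Sum>\<mu> | \<mu> + 2 \<le> r * b. e (c \<mu>) * (t ^ \<mu> * inverse y ^ b)) * D t"
    by (simp add: D_t divide_inverse power_inverse)
  also have "\<dots> \<in> Omega C (OU C)"
    using OU_ev[of "monom 1 1"]
    by (intro Omega_single OU_sum OU_mult OU_e OU_power OU_inverse_y) (simp_all add: ev_monom)
  finally have U: "?w \<in> Omega C (OU C)" .
  obtain A2 B2 where AB: "A2 * f2 + B2 * pderiv f2 = 1" using bezout_f2[OF bez] by blast
  define q where "q = (\<Sum>\<mu> | \<mu> + 2 \<le> r * b. monom (- c \<mu>) (r * b - 2 - \<mu>))"
  have term_eq: "e (c \<mu>) * (t ^ \<mu> / y ^ b) = e (- c \<mu>) * s ^ (r * b - 2 - \<mu>) * (inverse z ^ b * D s)"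
    if "\<mu> + 2 \<le> r * b" for \<mu>
  proof -
    have "r * b = r * b - 2 - \<mu> + 2 + \<mu>" using that by simp
    then have "s ^ (r * b) = s ^ (r * b - 2 - \<mu>) * s ^ 2 * s ^ \<mu>" by (metis power_add)
    then have zb: "z ^ b = s ^ (r * b - 2 - \<mu>) * s ^ 2 * s ^ \<mu> * y ^ b"
      by (simp only: zz_def power_mult_distrib power_mult)
    have "t ^ \<mu> = inverse (s ^ \<mu>)" by (simp add: ss_def power_inverse)
    then have "inverse z ^ b * s ^ (r * b - 2 - \<mu>) * s ^ 2 = t ^ \<mu> / y ^ b"
      by (simp add: power_inverse zb field_simps)
    then show ?thesis by (simp add: D_s e_simps algebra_simps)
  qed
  have "?w = ev C s q * (inverse z ^ b * D s)"
    unfolding q_def ev_simps ev_monom sum_distrib_right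
    by (intro sum.cong) (simp_all only: mem_Collect_eq term_eq)
  also have "inverse z ^ b * D s = inverse z ^ b * (ev C s (A2 * f2 + B2 * pderiv f2) * D s)"
    by (simp add: AB ev_simps)
  also have "\<dots> = inverse z ^ b * (ev C s A2 * z ^ n * D s + of_nat n * ev C s B2 * z ^ (n - 1) * D z)"
    using D_z by (simp add: ev_simps z_power_n algebra_simps)
  also have "\<dots> = ev C s A2 * z ^ (n - b) * D s + of_nat n * ev C s B2 * z ^ (n - 1 - b) * D z"
    using b by (simp add: power_inverse field_simps power_diff)
  also have "ev C s q * \<dots> = (ev C s q * (ev C s A2 * z ^ (n - b))) * D s
      + (ev C s q * (e (of_nat n) * ev C s B2 * z ^ (n - 1 - b))) * D z"
    by (simp add: algebra_simps e_simps)
  also have "\<dots> \<in> Omega C (OV r C)"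
    by (intro Omega_two OV_mult OV_ev OV_power OV_z OV_s OV_e)
  finally show ?thesis using U by (simp add: H0_def)
qed

section \<open>The splitting of de Rham cohomology\<close>

abbreviation "B1 \<equiv> OU_plus_OV r C"

lemma B1_I: "g \<in> OU C \<Longrightarrow> h \<in> OV r C \<Longrightarrow> g + h \<in> B1"
  by (auto simp: OU_plus_OV_def)

lemma B1_OU: "g \<in> OU C \<Longrightarrow> g \<in> B1" and B1_OV: "h \<in> OV r C \<Longrightarrow> h \<in> B1"
  using B1_I[of g 0] B1_I[of 0 h] OU_e[of 0] OV_e[of 0] by simp_all

lemma B1_0: "0 \<in> B1"
  using B1_OU[OF OU_e[of 0]] by simp

lemma B1_diff: "g \<in> B1 \<Longrightarrow> h \<in> B1 \<Longrightarrow> g - h \<in> B1"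
proof -
  assume "g \<in> B1" "h \<in> B1"
  then obtain gU gV hU hV where *: "g = gU + gV" "h = hU + hV" "gU \<in> OU C" "hU \<in> OU C"
    "gV \<in> OV r C" "hV \<in> OV r C" by (auto simp: OU_plus_OV_def)
  then have "g - h = (gU + - hU) + (gV + - hV)" by simp
  also have "\<dots> \<in> B1" using * by (intro B1_I OU_add OV_add OU_uminus OV_uminus)
  finally show ?thesis .
qed

lemma B1_add: "g \<in> B1 \<Longrightarrow> h \<in> B1 \<Longrightarrow> g + h \<in> B1"
  using B1_diff[of g "- h"] B1_diff[OF B1_0, of h] by simp

lemma B1_sum: "(\<And>x. x \<in> A \<Longrightarrow> g x \<in> B1) \<Longrightarrow> sum g A \<in> B1"
  by (induction A rule: infinite_finite_induct) (simp_all add: B1_add B1_0)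

lemma coset_B1: "coset B1 x = coset B1 x' \<longleftrightarrow> x - x' \<in> B1"
  by (rule coset_eq_iff) (auto intro: B1_0 B1_diff)

lemma hfun_eq: "hfun C (i, j) = s ^ i * y ^ j"
  by (simp add: hfun_def ss_def field_simps)

text \<open>
  Comparing coefficients of \<open>y\<^sup>j\<close>: a function on \<open>V\<close> has them in \<open>s\<^bsup>rj\<^esup> k[s]\<close>, and regularity on
  \<open>U \<inter> D(y)\<close> makes them constants, which vanish when \<open>j > 0\<close>.
\<close>

lemma OU_inter_OV:
  assumes "g \<in> OU C" "g \<in> OV r C"
  shows "\<exists>a. g = e a"
proof -
  obtain B where g: "g = (\<Sum>j<n. ev C s (B j * monom 1 (r * j)) * y ^ j)"
    using OV_normal_form[OF assms(2)] by blast
  have c: "coeff (B j * monom 1 (r * j)) m = 0" if "j < n" "m > 0" for j m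
    using constants_of_OU[OF f0 _ that] assms(1) g by metis
  have "ev C s (B j * monom 1 (r * j)) * y ^ j = (if j = 0 then e (coeff (B 0) 0) else 0)" if "j < n" for j
  proof (cases "j = 0")
    case True
    have "B 0 = [:coeff (B 0) 0:]"
      using c[OF that] True by (intro poly_eqI) (auto simp: coeff_pCons split: nat.split)
    then have "ev C s (B 0) = e (coeff (B 0) 0)" by (metis ev_const)
    then show ?thesis using True by simp
  next
    case False
    have "coeff (B j * monom 1 (r * j)) m = 0" for m
      using c[OF that, of m] False r_pos by (cases "m = 0") (auto simp: coeff_mult coeff_monom)
    then have "B j * monom 1 (r * j) = 0" by (intro poly_eqI) simp
    then show ?thesis using False by (simp only: ev_simps) simp
  qed
  then have "g = (\<Sum>j<n. if j = 0 then e (coeff (B 0) 0) else 0)" by (simp add: g)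
  also have "\<dots> = e (coeff (B 0) 0)" using n2 by simp
  finally show ?thesis by blast
qed

text \<open>
  Modulo functions on \<open>V\<close> only the coefficients of \<open>s\<^sup>i y\<^sup>j\<close> with \<open>i < r j\<close> matter, and regularity on
  \<open>U \<inter> D(y)\<close> kills those with \<open>i \<ge> 1\<close>.
\<close>

lemma hfun_independent:
  assumes u: "(\<Sum>x\<in>h_index n r. e (u x) * hfun C x) \<in> B1" and x: "x \<in> h_index n r"
  shows "u x = 0"
proof -
  obtain i j where ij: "x = (i, j)" "1 \<le> j" "j < n" "1 \<le> i" "i < r * j"
    using x by (auto simp: h_index_def)
  obtain gU gV where g: "(\<Sum>x\<in>h_index n r. e (u x) * hfun C x) = gU + gV" "gU \<in> OU C" "gV \<in> OV r C"
    using u by (auto simp: OU_plus_OV_def)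
  obtain B where B: "gV = (\<Sum>j<n. ev C s (B j * monom 1 (r * j)) * y ^ j)"
    using OV_normal_form[OF g(3)] by blast
  define E where "E j = (\<Sum>i\<in>{1..<r * j}. monom (u (i, j)) i)" for j
  have "(\<Sum>x\<in>h_index n r. e (u x) * hfun C x) = (\<Sum>j\<in>{1..<n}. ev C s (E j) * y ^ j)"
    by (simp add: sum_h_index E_def ev_simps ev_monom hfun_eq sum_distrib_right mult.assoc)
  also have "\<dots> = (\<Sum>j<n. ev C s (E j) * y ^ j)"
    by (rule sum.mono_neutral_left) (auto simp: E_def ev_simps Suc_le_eq)
  finally have "gU = (\<Sum>j<n. ev C s (E j - B j * monom 1 (r * j)) * y ^ j)"
    using g(1) by (simp add: B ev_simps left_diff_distrib sum_subtractf eq_diff_eq del: ev_simps(4))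
  then have "coeff (E j - B j * monom 1 (r * j)) i = 0"
    using constants_of_OU[OF f0 _ ij(3), of "\<lambda>j. E j - B j * monom 1 (r * j)" i] g(2) ij by simp
  moreover have "coeff (E j) i = u (i, j)"
    using ij by (simp add: E_def coeff_sum coeff_monom if_distrib cong: if_cong)
  moreover have "coeff (B j * monom 1 (r * j)) i = 0"
    using ij(5) coeff_monom_mult[of 1 "r * j" "B j" i] by (simp add: mult.commute[of "B j"])
  ultimately show ?thesis by (simp add: ij)
qed

text \<open>
  As \<open>f(0) \<noteq> 0\<close>, partial fractions split the coefficients of \<open>y\<^sup>j\<close> into a part in \<open>k[t, 1/f]\<close> and a
  Laurent polynomial in \<open>t\<close>. In the latter, \<open>s\<^sup>i y\<^sup>j\<close> extends to \<open>U \<inter> D(y)\<close> for \<open>i \<le> 0\<close>, to \<open>V\<close> for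
  \<open>i \<ge> r j\<close>, and is a basis element in between.
\<close>

lemma hfun_spans:
  assumes "g \<in> OUV C"
  obtains u where "\<And>x. x \<notin> h_index n r \<Longrightarrow> u x = 0"
    "g - (\<Sum>x\<in>h_index n r. e (u x) * hfun C x) \<in> B1"
proof -
  obtain A M where A: "g * (t ^ M * ev C t f ^ M) = (\<Sum>j<n. ev C t (A j) * y ^ j)"
    using OUV_normal_form[OF assms] by blast
  obtain w where "f = pCons (poly f 0) w" by (metis poly_pCons mult_zero_left add_0_right pCons_cases)
  then have w: "f = [:poly f 0:] + monom 1 1 * w" by (simp add: monom_altdef)
  have "smult (inverse (poly f 0)) 1 * f + (- smult (inverse (poly f 0)) w) * monom 1 1 = 1"
    using f0 by (subst (2) w) (simp add: algebra_simps one_pCons)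
  then obtain S T where ST: "S * f ^ M + T * monom 1 1 ^ M = 1" using bezout_powers by blast
  define u where "u x = (if x \<in> h_index n r \<and> fst x \<le> M then coeff (A (snd x) * S) (M - fst x) else 0)" for x
  have "ev C t (A j * S) * s ^ M * y ^ j - (\<Sum>i\<in>{1..<r * j}. e (u (i, j)) * hfun C (i, j)) \<in> B1"
    if j: "j < n" for j
  proof -
    let ?c = "\<lambda>m. e (coeff (A j * S) m)"
    define N where "N = max (degree (A j * S)) M"
    have "ev C t (A j * S) * s ^ M = (\<Sum>m\<le>N. ?c m * (t ^ m * s ^ M))"
      by (simp add: ev_eq_sum[of _ N] N_def sum_distrib_right mult.assoc)
    also have "{..N} = {..<M} \<union> {M..N}" by (auto simp: N_def)
    also have "(\<Sum>m\<in>\<dots>. ?c m * (t ^ m * s ^ M)) =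
        (\<Sum>m<M. ?c m * (t ^ m * s ^ M)) + (\<Sum>m\<in>{M..N}. ?c m * (t ^ m * s ^ M))"
      by (rule sum.union_disjoint) auto
    also have "(\<Sum>m\<in>{M..N}. ?c m * (t ^ m * s ^ M)) = (\<Sum>m\<in>{M..N}. ?c m * t ^ (m - M))"
      by (intro sum.cong) (simp_all add: t_power_s_power)
    also have "(\<Sum>m<M. ?c m * (t ^ m * s ^ M)) = (\<Sum>i\<in>{1..M}. ?c (M - i) * s ^ i)"
      by (rule sum.reindex_bij_witness[of _ "\<lambda>i. M - i" "\<lambda>m. M - m"]) (auto simp: t_power_s_power)
    finally have 1: "ev C t (A j * S) * s ^ M =
        (\<Sum>i\<in>{1..M}. ?c (M - i) * s ^ i) + (\<Sum>m\<in>{M..N}. ?c m * t ^ (m - M))" .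
    have 2: "(\<Sum>i\<in>{1..<r * j}. e (u (i, j)) * hfun C (i, j)) =
        (\<Sum>i\<in>{1..M}. if i < r * j then ?c (M - i) * (s ^ i * y ^ j) else 0)"
      using j by (intro sum.mono_neutral_cong) (auto simp: u_def hfun_eq h_index_def Suc_le_eq)
    have "ev C t (A j * S) * s ^ M * y ^ j - (\<Sum>i\<in>{1..<r * j}. e (u (i, j)) * hfun C (i, j)) =
        (\<Sum>i\<in>{1..M}. if i < r * j then 0 else ?c (M - i) * (s ^ i * y ^ j))
        + (\<Sum>m\<in>{M..N}. ?c m * t ^ (m - M)) * y ^ j"
      unfolding 1 2 distrib_right sum_distrib_right
      by (simp add: mult.assoc flip: sum_subtractf) (intro sum.cong, auto)
    also have "\<dots> \<in> B1"
    proof (intro B1_add B1_sum)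
      show "(if i < r * j then 0 else ?c (M - i) * (s ^ i * y ^ j)) \<in> B1" for i
        using B1_OV OV_mult OV_e OV_monomial B1_0 by simp
      have "t \<in> OU C" using OU_ev[of "monom 1 1"] by (simp add: ev_monom)
      then show "(\<Sum>m\<in>{M..N}. ?c m * t ^ (m - M)) * y ^ j \<in> B1"
        by (intro B1_OU OU_mult OU_sum OU_e OU_power OU_y)
    qed
    finally show ?thesis .
  qed
  then have "(\<Sum>j<n. ev C t (A j * S) * s ^ M * y ^ j
      - (\<Sum>i\<in>{1..<r * j}. e (u (i, j)) * hfun C (i, j))) \<in> B1"
    by (intro B1_sum) simp
  moreover have "(\<Sum>j<n. ev C t (A j * T) * inverse (ev C t f) ^ M * y ^ j) \<in> B1"
    by (intro B1_OU OU_mult OU_sum OU_power OU_y OU_ev OU_inverse_f)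
  ultimately have "(\<Sum>j<n. ev C t (A j * S) * s ^ M * y ^ j
      - (\<Sum>i\<in>{1..<r * j}. e (u (i, j)) * hfun C (i, j)))
      + (\<Sum>j<n. ev C t (A j * T) * inverse (ev C t f) ^ M * y ^ j) \<in> B1"
    by (rule B1_add)
  moreover have "g = (\<Sum>j<n. ev C t (A j * S) * s ^ M * y ^ j)
      + (\<Sum>j<n. ev C t (A j * T) * inverse (ev C t f) ^ M * y ^ j)"
  proof -
    have "g = (g * (t ^ M * ev C t f ^ M)) * (s ^ M * inverse (ev C t f) ^ M)"
      by (simp add: ss_def field_simps)
    also have "\<dots> = (\<Sum>j<n. ev C t (A j) * y ^ j) * (s ^ M * inverse (ev C t f) ^ M)"
      by (simp only: A)
    also have "\<dots> = (\<Sum>j<n. ev C t (A j * (S * f ^ M + T * monom 1 1 ^ M)) * y ^ j)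
        * (s ^ M * inverse (ev C t f) ^ M)"
      by (simp only: ST mult_1_right)
    also have "\<dots> = (\<Sum>j<n. ev C t (A j * S) * s ^ M * y ^ j)
      + (\<Sum>j<n. ev C t (A j * T) * inverse (ev C t f) ^ M * y ^ j)"
      unfolding sum_distrib_right sum.distrib[symmetric]
      by (intro sum.cong) (simp_all add: ev_simps ev_monom ss_def field_simps)
    finally show ?thesis .
  qed
  moreover have "(\<Sum>x\<in>h_index n r. e (u x) * hfun C x) =
      (\<Sum>j<n. \<Sum>i\<in>{1..<r * j}. e (u (i, j)) * hfun C (i, j))"
    unfolding sum_h_index by (rule sum.mono_neutral_left) (auto simp: Suc_le_eq)
  ultimately have "g - (\<Sum>x\<in>h_index n r. e (u x) * hfun C x) \<in> B1"
    by (simp add: sum_subtractf algebra_simps)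
  then show ?thesis using that[of u] by (simp add: u_def)
qed

lemma h_coords_eq:
  assumes "\<And>x. x \<notin> h_index n r \<Longrightarrow> u x = 0"
    and "X = coset B1 (\<Sum>x\<in>h_index n r. e (u x) * hfun C x)"
  shows "h_coords n r C X = u"
  unfolding h_coords_def
proof (rule the_equality)
  fix u' assume u': "(\<forall>x. x \<notin> h_index n r \<longrightarrow> u' x = 0) \<and> X = coset B1 (\<Sum>x\<in>h_index n r. e (u' x) * hfun C x)"
  then have "coset B1 (\<Sum>x\<in>h_index n r. e (u' x) * hfun C x) = coset B1 (\<Sum>x\<in>h_index n r. e (u x) * hfun C x)"
    using assms(2) by simp
  then have "(\<Sum>x\<in>h_index n r. e (u' x - u x) * hfun C x) \<in> B1"
    unfolding coset_B1 by (simp add: e_simps left_diff_distrib sum_subtractf)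
  then have "u' x - u x = 0" if "x \<in> h_index n r" for x using hfun_independent that by metis
  then show "u' = u" using u' assms(1) by (intro ext) (metis right_minus_eq)
qed (use assms in blast)

lemma H1O_E:
  assumes "X \<in> H1O r C"
  obtains u where "\<And>x. x \<notin> h_index n r \<Longrightarrow> u x = 0" "h_coords n r C X = u"
    "X = coset B1 (\<Sum>x\<in>h_index n r. e (u x) * hfun C x)"
proof -
  obtain g where g: "g \<in> OUV C" "X = coset B1 g" using assms by (auto simp: H1O_def)
  obtain u where u: "\<And>x. x \<notin> h_index n r \<Longrightarrow> u x = 0"
    "g - (\<Sum>x\<in>h_index n r. e (u x) * hfun C x) \<in> B1" using hfun_spans[OF g(1)] by blast
  then have "X = coset B1 (\<Sum>x\<in>h_index n r. e (u x) * hfun C x)" using g(2) coset_B1 by simp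
  with u(1) h_coords_eq that show ?thesis by metis
qed

lemma BDR_0: "0 \<in> BDR r C"
  using OU_e[of 0] OV_e[of 0] D_0 unfolding BDR_def by (force simp: zero_prod_def)

lemma BDR_diff: "x \<in> BDR r C \<Longrightarrow> x' \<in> BDR r C \<Longrightarrow> x - x' \<in> BDR r C"
proof -
  assume "x \<in> BDR r C" "x' \<in> BDR r C"
  then obtain gU gV hU hV where *: "x = (D gU, - D gV, gU + gV)" "x' = (D hU, - D hV, hU + hV)"
    "gU \<in> OU C" "hU \<in> OU C" "gV \<in> OV r C" "hV \<in> OV r C" by (auto simp: BDR_def)
  then have "x - x' = (D (gU + - hU), - D (gV + - hV), (gU + - hU) + (gV + - hV))"
    by (simp add: D_diff)
  moreover have "gU + - hU \<in> OU C" "gV + - hV \<in> OV r C" using * by (intro OU_add OV_add OU_uminus OV_uminus; simp)+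
  ultimately show ?thesis unfolding BDR_def by blast
qed

lemma coset_BDR: "coset (BDR r C) x = coset (BDR r C) x' \<longleftrightarrow> x - x' \<in> BDR r C"
  by (rule coset_eq_iff) (auto intro: BDR_0 BDR_diff)

lemma tau_eq:
  "tau n r f C X = ((\<Sum>x\<in>h_index n r. e (h_coords n r C X x) * alphaU n f C x),
     - (\<Sum>x\<in>h_index n r. e (h_coords n r C X x) * alphaV n r f C x),
     (\<Sum>x\<in>h_index n r. e (h_coords n r C X x) * hfun C x))"
  unfolding tau_def Let_def by (rule sum_triple[OF finite_h_index])

text \<open>
  The function parts determine the class in \<open>H\<^sup>1\<close> by independence of the \<open>h\<^sub>i\<^sub>j\<close>. What remains is a
  coboundary \<open>(dh\<^sub>U, -dh\<^sub>V, h\<^sub>U + h\<^sub>V)\<close> with \<open>h\<^sub>U = -h\<^sub>V\<close> a global function, hence constant.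
\<close>

lemma split_DR_inj: "inj_on (split_DR n r f C) (H0 r C \<times> H1O r C)"
proof (rule inj_onI, clarify)
  fix \<omega> X \<omega>' X'
  assume X: "X \<in> H1O r C" "X' \<in> H1O r C" and eq: "split_DR n r f C (\<omega>, X) = split_DR n r f C (\<omega>', X')"
  obtain u where u: "\<And>x. x \<notin> h_index n r \<Longrightarrow> u x = 0" "h_coords n r C X = u"
    "X = coset B1 (\<Sum>x\<in>h_index n r. e (u x) * hfun C x)" by (rule H1O_E[OF X(1)]) blast
  obtain u' where u': "\<And>x. x \<notin> h_index n r \<Longrightarrow> u' x = 0" "h_coords n r C X' = u'"
    "X' = coset B1 (\<Sum>x\<in>h_index n r. e (u' x) * hfun C x)" by (rule H1O_E[OF X(2)]) blast
  have d: "((\<omega>, \<omega>, 0) + tau n r f C X) - ((\<omega>', \<omega>', 0) + tau n r f C X') \<in> BDR r C"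
    using eq coset_BDR by (simp add: split_DR_def)
  then obtain hU hV where h: "hU \<in> OU C" "hV \<in> OV r C"
    "((\<omega>, \<omega>, 0) + tau n r f C X) - ((\<omega>', \<omega>', 0) + tau n r f C X') = (D hU, - D hV, hU + hV)"
    unfolding BDR_def by blast
  then have "(\<Sum>x\<in>h_index n r. e (u x) * hfun C x) - (\<Sum>x\<in>h_index n r. e (u' x) * hfun C x) \<in> B1"
    using B1_I by (simp add: tau_eq u(2) u'(2))
  then have XX: "X = X'" using u(3) u'(3) coset_B1 by simp
  with h(3) have "hU + hV = 0" "\<omega> - \<omega>' = D hU" by (simp_all add: tau_eq)
  then have "hU = - hV" by (simp add: eq_neg_iff_add_eq_0)
  then have "hU \<in> OV r C" using OV_uminus[OF h(2)] by simp
  then obtain a where "hU = e a" using OU_inter_OV[OF h(1)] by blast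
  then have "\<omega> = \<omega>'" using \<open>\<omega> - \<omega>' = D hU\<close> by (simp add: D_e)
  with XX show "\<omega> = \<omega>' \<and> X = X'" by simp
qed

text \<open>
  To project a class it suffices to exhibit a global form, coordinates on the \<open>h\<^sub>i\<^sub>j\<close> and a coboundary that
  add up to a representative, because the splitting is injective.
\<close>

lemma proj2_eq:
  assumes \<omega>: "\<omega> \<in> H0 r C" and u: "\<And>x. x \<notin> h_index n r \<Longrightarrow> u x = 0"
    and h: "hU \<in> OU C" "hV \<in> OV r C"
    and 1: "\<eta>U = \<omega> + (\<Sum>x\<in>h_index n r. e (u x) * alphaU n f C x) + D hU"
    and 2: "\<eta>V = \<omega> - (\<Sum>x\<in>h_index n r. e (u x) * alphaV n r f C x) - D hV"
    and 3: "\<eta> = (\<Sum>x\<in>h_index n r. e (u x) * hfun C x) + hU + hV"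
  shows "proj2 n r f C (coset (BDR r C) (\<eta>U, \<eta>V, \<eta>)) = \<omega>"
proof -
  define X where "X = coset B1 (\<Sum>x\<in>h_index n r. e (u x) * hfun C x)"
  have c: "h_coords n r C X = u" by (rule h_coords_eq[OF u]) (simp_all add: X_def)
  have X: "X \<in> H1O r C"
    unfolding X_def H1O_def
    by (rule imageI) (auto intro!: OUV_sum OUV_mult OUV_e simp: hfun_eq OUV_power OUV_s OUV_y)
  have "(\<eta>U, \<eta>V, \<eta>) - ((\<omega>, \<omega>, 0) + tau n r f C X) = (D hU, - D hV, hU + hV)"
    by (simp add: tau_eq c 1 2 3)
  also have "\<dots> \<in> BDR r C" using h by (auto simp: BDR_def)
  finally have "coset (BDR r C) (\<eta>U, \<eta>V, \<eta>) = split_DR n r f C (\<omega>, X)"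
    using coset_BDR by (simp add: split_DR_def)
  then show ?thesis
    unfolding proj2_def using the_inv_into_f_f[OF split_DR_inj, of "(\<omega>, X)"] \<omega> X by simp
qed

end

section \<open>Laurent expansions at \<open>t = 0\<close>\<close>

context superelliptic_field
begin

lemma ev_t_reversed: "ev C t (reversed K q) = (\<Sum>\<mu>\<le>K. e (coeff q (K - \<mu>)) * t ^ \<mu>)"
  unfolding reversed_def ev_simps ev_monom
  by (rule sum.reindex_bij_witness[of _ "\<lambda>\<mu>. K - \<mu>" "\<lambda>m. K - m"]) auto

lemma t_power_ev_s:
  assumes "degree q \<le> K + N"
  shows "t ^ K * ev C s q = ev C t (reversed K q) + (\<Sum>m\<in>{1..N}. e (coeff q (K + m)) * s ^ m)"
proof -
  have "t ^ K * ev C s q = (\<Sum>m\<le>K + N. e (coeff q m) * (t ^ K * s ^ m))"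
    by (simp add: ev_eq_sum[OF assms] sum_distrib_left mult_ac)
  also have "{..K + N} = {..K} \<union> {K + 1..K + N}" by auto
  also have "(\<Sum>m\<in>\<dots>. e (coeff q m) * (t ^ K * s ^ m)) =
      (\<Sum>m\<le>K. e (coeff q m) * (t ^ K * s ^ m)) + (\<Sum>m\<in>{K + 1..K + N}. e (coeff q m) * (t ^ K * s ^ m))"
    by (rule sum.union_disjoint) auto
  also have "(\<Sum>m\<le>K. e (coeff q m) * (t ^ K * s ^ m)) = ev C t (reversed K q)"
    unfolding reversed_def ev_simps ev_monom by (intro sum.cong) (simp_all add: t_power_s_power)
  also have "(\<Sum>m\<in>{K + 1..K + N}. e (coeff q m) * (t ^ K * s ^ m)) =
      (\<Sum>m\<in>{1..N}. e (coeff q (K + m)) * s ^ m)"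
    by (rule sum.reindex_bij_witness[of _ "\<lambda>m. K + m" "\<lambda>m. m - K"]) (auto simp: t_power_s_power)
  finally show ?thesis .
qed

text \<open>
  The ring \<open>k[t, 1/f]\<close>, which contains the coefficients of powers of \<open>y\<close> in functions on \<open>U \<inter> D(y)\<close>.
\<close>

definition poly_loc :: "'a set" where
  "poly_loc = {x. \<exists>M g. x * ev C t f ^ M = ev C t g}"

text \<open>
  The space \<open>s k[s]\<close> of Laurent polynomials in \<open>t\<close> with only negative exponents.
\<close>

definition polar :: "'a set" where
  "polar = {x. \<exists>q. coeff q 0 = 0 \<and> x = ev C s q}"

lemma poly_loc_ev: "ev C t q \<in> poly_loc"
  unfolding poly_loc_def by (intro CollectI exI[of _ 0] exI[of _ q]) simp

lemma poly_loc_e: "e a \<in> poly_loc"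
  using poly_loc_ev[of "[:a:]"] by (simp add: ev_const)

lemma poly_loc_t: "t \<in> poly_loc"
  using poly_loc_ev[of "monom 1 1"] by (simp add: ev_monom)

lemma poly_loc_inverse_f: "inverse (ev C t f) \<in> poly_loc"
  unfolding poly_loc_def by (intro CollectI exI[of _ 1] exI[of _ 1]) (simp add: ev_simps)

lemma poly_loc_add: "x \<in> poly_loc \<Longrightarrow> x' \<in> poly_loc \<Longrightarrow> x + x' \<in> poly_loc"
  and poly_loc_mult: "x \<in> poly_loc \<Longrightarrow> x' \<in> poly_loc \<Longrightarrow> x * x' \<in> poly_loc"
proof -
  assume "x \<in> poly_loc" "x' \<in> poly_loc"
  then obtain M g M' g' where x: "x * ev C t f ^ M = ev C t g" "x' * ev C t f ^ M' = ev C t g'"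
    by (auto simp: poly_loc_def)
  have "(x + x') * ev C t f ^ (M + M') =
      (x * ev C t f ^ M) * ev C t f ^ M' + (x' * ev C t f ^ M') * ev C t f ^ M"
    by (simp add: power_add algebra_simps)
  also have "\<dots> = ev C t (g * f ^ M' + g' * f ^ M)" by (simp add: x ev_simps)
  finally show "x + x' \<in> poly_loc" unfolding poly_loc_def by blast
  have "x * x' * ev C t f ^ (M + M') = (x * ev C t f ^ M) * (x' * ev C t f ^ M')"
    by (simp add: power_add mult_ac)
  also have "\<dots> = ev C t (g * g')" by (simp add: x ev_simps)
  finally show "x * x' \<in> poly_loc" unfolding poly_loc_def by blast
qed

lemma poly_loc_uminus: "x \<in> poly_loc \<Longrightarrow> - x \<in> poly_loc"
  using poly_loc_mult[OF poly_loc_e[of "-1"]] by (simp add: e_simps)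

lemma poly_loc_diff: "x \<in> poly_loc \<Longrightarrow> x' \<in> poly_loc \<Longrightarrow> x - x' \<in> poly_loc"
  using poly_loc_add[OF _ poly_loc_uminus] by simp

lemma poly_loc_power: "x \<in> poly_loc \<Longrightarrow> x ^ m \<in> poly_loc"
  by (induction m) (use poly_loc_e[of 1] in \<open>simp_all add: poly_loc_mult\<close>)

lemma poly_loc_sum: "(\<And>x. x \<in> A \<Longrightarrow> g x \<in> poly_loc) \<Longrightarrow> sum g A \<in> poly_loc"
  by (induction A rule: infinite_finite_induct) (use poly_loc_e[of 0] in \<open>simp_all add: poly_loc_add\<close>)

lemma ev_f_nonzero: "ev C t f \<noteq> 0"
  by simp

lemma poly_loc_D: "x \<in> poly_loc \<Longrightarrow> D x \<in> poly_loc"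
proof -
  assume "x \<in> poly_loc"
  then obtain M g where x: "x * ev C t f ^ M = ev C t g" by (auto simp: poly_loc_def)
  have "D x = D (ev C t g * inverse (ev C t f) ^ M)" by (simp add: power_inverse field_simps flip: x)
  also have "\<dots> = ev C t g * (e (of_nat M) * inverse (ev C t f) ^ (M - 1) *
      (- ev C t (pderiv f) * inverse (ev C t f) ^ 2)) + inverse (ev C t f) ^ M * ev C t (pderiv g)"
    unfolding D_mult D_power D_ev D_t D_inverse[OF ev_f_nonzero]
    by (simp add: e_simps power_inverse divide_inverse mult_ac)
  also have "\<dots> \<in> poly_loc"
    by (intro poly_loc_add poly_loc_mult poly_loc_ev poly_loc_e poly_loc_power poly_loc_uminus poly_loc_inverse_f)
  finally show ?thesis .
qed

lemma polar_add: "x \<in> polar \<Longrightarrow> x' \<in> polar \<Longrightarrow> x + x' \<in> polar"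
  unfolding polar_def by (force simp: ev_simps intro: exI[of _ "_ + _"])

lemma polar_e_mult: "x \<in> polar \<Longrightarrow> e a * x \<in> polar"
  unfolding polar_def by (force simp: ev_smult intro: exI[of _ "smult _ _"])

lemma polar_power: "m > 0 \<Longrightarrow> s ^ m \<in> polar"
  unfolding polar_def by (intro CollectI exI[of _ "monom 1 m"]) (simp add: ev_monom)

lemma polar_sum: "(\<And>x. x \<in> A \<Longrightarrow> g x \<in> polar) \<Longrightarrow> sum g A \<in> polar"
proof (induction A rule: infinite_finite_induct)
  have "0 \<in> polar" unfolding polar_def by (intro CollectI exI[of _ 0]) (simp add: ev_simps)
  then show "sum g {} \<in> polar" "\<And>A. infinite A \<Longrightarrow> sum g A \<in> polar" by simp_all
qed (simp add: polar_add)

lemma poly_loc_polar: "poly f 0 \<noteq> 0 \<Longrightarrow> x \<in> poly_loc \<Longrightarrow> x \<in> polar \<Longrightarrow> x = 0"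
proof -
  assume f0: "poly f 0 \<noteq> 0" and "x \<in> poly_loc" "x \<in> polar"
  then obtain M g q where x: "x * ev C t f ^ M = ev C t g" "coeff q 0 = 0" "x = ev C s q"
    by (auto simp: poly_loc_def polar_def)
  have "q = 0"
    using constant_of_regular_at_0[OF f0 x(1)[unfolded x(3)]] x(2) by (intro poly_eqI) (metis coeff_0 neq0_conv)
  then show ?thesis by (simp add: x)
qed

end

context superelliptic_curve
begin

text \<open>
  The coefficient of \<open>t\<^bsup>m-i-1\<^esup>\<close> in \<open>y\<^bsup>n-j\<^esup> d(t\<^bsup>-i\<^esup> y\<^sup>j)\<close>. The forms \<open>\<alpha>\<^sup>U\<close> and \<open>\<alpha>\<^sup>V\<close> collect the terms
  with \<open>m > i\<close> and with \<open>m \<le> i\<close>; the opposite sign in \<open>\<alpha>\<^sup>V\<close> comes from \<open>ds = -s\<^sup>2 dt\<close>.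
\<close>

definition alpha_coeff :: "nat \<Rightarrow> nat \<Rightarrow> nat \<Rightarrow> 'k" where
  "alpha_coeff i j m = (of_nat (j * m) - of_nat (i * n)) / of_nat n * coeff f m"

lemma alphaU_y:
  assumes "1 \<le> j" "j + 1 \<le> n"
  shows "alphaU n f C (i, j) * y ^ (n - j) = (\<Sum>m = i + 1..degree f. e (alpha_coeff i j m) * t ^ (m - (i + 1)))"
    (is "_ = ?S")
proof -
  have alphaU_eq: "alphaU n f C (i, j) * y ^ (n - j) = ?S * (y ^ (j - 1) / y ^ (n - 1) * y ^ (n - j))"
    by (simp add: alphaU_def alpha_coeff_def)
  have "n - 1 = j - 1 + (n - j)" using assms by simp
  then have "y ^ (n - 1) = y ^ (j - 1) * y ^ (n - j)" by (metis power_add)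
  then have "y ^ (j - 1) / y ^ (n - 1) * y ^ (n - j) = 1" by simp
  then show ?thesis unfolding alphaU_eq by simp
qed

lemma alphaV_y:
  assumes "1 \<le> j" "j + 1 \<le> n"
  shows "alphaV n r f C (i, j) * y ^ (n - j) = (\<Sum>m = 0..i. e (alpha_coeff i j m) * s ^ (i + 1 - m))"
proof -
  let ?N = "(n - j) * r"
  have N: "?N \<ge> 1" using assms r_pos by (simp add: Suc_le_eq)
  have "n - 1 = j - 1 + (n - j)" using assms by simp
  then have "z ^ (n - 1) = z ^ (j - 1) * z ^ (n - j)" by (metis power_add)
  moreover have "z ^ (n - j) = s ^ ?N * y ^ (n - j)"
    by (simp add: zz_def power_mult_distrib mult.commute flip: power_mult)
  ultimately have z: "z ^ (j - 1) / z ^ (n - 1) * y ^ (n - j) * s ^ ?N = 1" by simp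
  have "e ((of_nat (i * n) - of_nat (j * m)) / of_nat n * coeff f m) * s ^ (i + 1 + ?N - 2 - m) * D s =
      s ^ ?N * (e (alpha_coeff i j m) * s ^ (i + 1 - m))" if "m \<le> i" for m
  proof -
    have "i + 1 + K - 2 - m + 2 = K + (i + 1 - m)" if "K \<ge> 1" for K using that \<open>m \<le> i\<close> by simp
    from this[OF N] have "i + 1 + ?N - 2 - m + 2 = ?N + (i + 1 - m)" .
    then have "s ^ (i + 1 + ?N - 2 - m) * s ^ 2 = s ^ ?N * s ^ (i + 1 - m)" by (metis power_add)
    moreover have "e ((of_nat (i * n) - of_nat (j * m)) / of_nat n * coeff f m) = - e (alpha_coeff i j m)"
      unfolding alpha_coeff_def by (simp add: e_simps minus_divide_left flip: mult_minus_left)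
    ultimately show ?thesis by (simp add: D_s)
  qed
  then have sum: "(\<Sum>m = 0..i. e ((of_nat (i * n) - of_nat (j * m)) / of_nat n * coeff f m)
      * s ^ (i + 1 + ?N - 2 - m)) * D s = s ^ ?N * (\<Sum>m = 0..i. e (alpha_coeff i j m) * s ^ (i + 1 - m))"
    unfolding sum_distrib_left sum_distrib_right by (intro sum.cong) auto
  have "alphaV n r f C (i, j) * y ^ (n - j) =
      ((\<Sum>m = 0..i. e ((of_nat (i * n) - of_nat (j * m)) / of_nat n * coeff f m)
      * s ^ (i + 1 + ?N - 2 - m)) * D s) * (z ^ (j - 1) / z ^ (n - 1) * y ^ (n - j))"
    by (simp add: alphaV_def mult_ac)
  also have "\<dots> = (\<Sum>m = 0..i. e (alpha_coeff i j m) * s ^ (i + 1 - m)) *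
      (z ^ (j - 1) / z ^ (n - 1) * y ^ (n - j) * s ^ ?N)"
    unfolding sum by (simp only: mult_ac)
  finally show ?thesis by (simp only: z mult_1_right)
qed

text \<open>
  Here \<open>i\<close> is arbitrary: for \<open>i \<ge> r j\<close> the function \<open>h\<^sub>i\<^sub>j\<close> is no longer a basis element but regular on \<open>V\<close>,
  and it is there that the formula produces the double sum of the theorem.
\<close>

lemma D_hfun:
  assumes "1 \<le> j" "j + 1 \<le> n"
  shows "D (hfun C (i, j)) = alphaU n f C (i, j) + alphaV n r f C (i, j)"
proof -
  let ?N = "degree f + i" and ?w = "\<lambda>m. e (alpha_coeff i j m)"
  have "n - 1 = j - 1 + (n - j)" "n = j + (n - j)" using assms by simp_all
  then have y: "y ^ (n - 1) = y ^ (j - 1) * y ^ (n - j)" "y ^ n = y ^ j * y ^ (n - j)" by (metis power_add)+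
  have Ds: "D (s ^ i) = - (of_nat i * s ^ (i + 1))"
    using D_power[of s i] by (cases i) (simp_all add: D_s power2_eq_square mult_ac)
  have "D (hfun C (i, j)) * y ^ (n - j) =
      s ^ i * of_nat j * (y ^ (n - 1) * D y) - of_nat i * s ^ (i + 1) * y ^ n"
    unfolding hfun_eq D_mult[of "s ^ i"] Ds D_power[of y] y by (simp add: algebra_simps)
  also have "y ^ (n - 1) * D y = ev C t (pderiv f) / of_nat n"
    using D_y by (simp add: field_simps)
  also have "s ^ i = s ^ (i + 1) * t" by simp
  also have "s ^ (i + 1) * t * of_nat j * (ev C t (pderiv f) / of_nat n) - of_nat i * s ^ (i + 1) * y ^ n =
      s ^ (i + 1) * ev C t (smult (of_nat j / of_nat n) (pCons 0 (pderiv f)) - smult (of_nat i) f)"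
    unfolding y_power_n ev_simps ev_smult ev_pCons e_simps by (simp add: algebra_simps)
  also have "ev C t (smult (of_nat j / of_nat n) (pCons 0 (pderiv f)) - smult (of_nat i) f) =
      (\<Sum>m\<le>?N. ?w m * t ^ m)"
  proof (subst ev_eq_sum[of _ ?N])
    show "degree (smult (of_nat j / of_nat n) (pCons 0 (pderiv f)) - smult (of_nat i) f) \<le> ?N"
      by (rule degree_le) (auto simp: coeff_pCons coeff_pderiv coeff_eq_0 split: nat.split)
    have "coeff (pCons 0 (pderiv f)) m = of_nat m * coeff f m" for m
      by (auto simp: coeff_pCons coeff_pderiv split: nat.split)
    then have "coeff (smult (of_nat j / of_nat n) (pCons 0 (pderiv f)) - smult (of_nat i) f) m =
        alpha_coeff i j m" for m
      using n_unit by (simp add: alpha_coeff_def field_simps del: smult_pCons)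
    then show "(\<Sum>m\<le>?N. e (coeff (smult (of_nat j / of_nat n) (pCons 0 (pderiv f)) - smult (of_nat i) f) m) * t ^ m)
        = (\<Sum>m\<le>?N. ?w m * t ^ m)" by simp
  qed
  also have "s ^ (i + 1) * \<dots> = (\<Sum>m\<le>?N. ?w m * (t ^ m * s ^ (i + 1)))"
    by (simp add: sum_distrib_left mult_ac)
  also have "{..?N} = {0..i} \<union> {i + 1..?N}" by auto
  also have "(\<Sum>m\<in>\<dots>. ?w m * (t ^ m * s ^ (i + 1))) =
      (\<Sum>m = 0..i. ?w m * (t ^ m * s ^ (i + 1))) + (\<Sum>m = i + 1..?N. ?w m * (t ^ m * s ^ (i + 1)))"
    by (rule sum.union_disjoint) auto
  also have "(\<Sum>m = 0..i. ?w m * (t ^ m * s ^ (i + 1))) = (\<Sum>m = 0..i. ?w m * s ^ (i + 1 - m))"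
    by (intro sum.cong) (simp_all add: t_power_s_power del: power_Suc)
  also have "(\<Sum>m = i + 1..?N. ?w m * (t ^ m * s ^ (i + 1))) = (\<Sum>m = i + 1..degree f. ?w m * t ^ (m - (i + 1)))"
    by (rule sum.mono_neutral_cong_right)
      (auto simp: t_power_s_power alpha_coeff_def coeff_eq_0 simp del: power_Suc)
  finally have "D (hfun C (i, j)) * y ^ (n - j) = (alphaU n f C (i, j) + alphaV n r f C (i, j)) * y ^ (n - j)"
    by (simp add: alphaU_y[OF assms] alphaV_y[OF assms] distrib_right)
  then show ?thesis by simp
qed

end

section \<open>The projection of the Frobenius image\<close>

lemma dvd_power_minus_1: "q dvd x - 1 \<Longrightarrow> q dvd x ^ m - (1 :: 'a::comm_ring_1)"
proof (induction m)
  case (Suc m)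
  have "x ^ Suc m - 1 = x * (x ^ m - 1) + (x - 1)" by (simp add: algebra_simps)
  then show ?case using Suc by (simp only: dvd_add dvd_mult)
qed simp

lemma finite_below: "finite {\<mu>::nat. \<mu> + 2 \<le> N}"
  by (rule finite_subset[of _ "{..N}"]) auto

context superelliptic_curve
begin

lemma Frobenius_y_power: "p * j = n * a + b \<Longrightarrow> y ^ (p * j) = ev C t f ^ a * y ^ b"
  by (simp add: power_add power_mult y_power_n)

lemma t_power_split: "t ^ (p * (i + 2)) = t ^ (p * i) * t ^ (2 * p)"
proof -
  have "p * (i + 2) = p * i + 2 * p" by simp
  then show ?thesis by (simp only: power_add)
qed

text \<open>
  The error of replacing \<open>f\<^bsup>-(a+1)\<^esup>\<close> by \<open>IP\<close> is \<open>t\<^bsup>d+1\<^esup> P / f\<^bsup>a+1\<^esup>\<close>. Multiplied by \<open>t\<^bsup>p(i+2)\<^esup> v(s)\<close> it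
  stays regular at \<open>t = 0\<close>, because \<open>deg v \<le> d + 2 p\<close>. The product \<open>t\<^bsup>p(i+2)\<^esup> v(s) IP(t)\<close> is expanded in
  powers of \<open>t\<close>, the nonnegative ones being absorbed in \<open>X\<close>. No pole of order
  above \<open>d\<close> occurs, and the freedom in \<open>N\<close> lets the sum be cut at \<open>r (n - b)\<close> even when that exceeds \<open>d\<close>.
\<close>

lemma h_component:
  fixes v I :: "'k poly"
  assumes b: "1 \<le> b" "b + 1 \<le> n" and pj: "p * j = n * a + b"
    and v: "degree v \<le> d + 2 * p" and I: "monom 1 (d + 1) dvd f * I - 1" and N: "d \<le> N"
  defines "IP \<equiv> I ^ (a + 1)"
  shows "\<exists>X\<in>poly_loc. t ^ (p * i) / y ^ (p * j) * t ^ (2 * p) * ev C s v =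
    (\<Sum>m\<in>{1..N}. e (\<Sum>k\<le>degree IP. coeff IP k * coeff v (p * (i + 2) + k + m)) * hfun C (m, n - b))
    + X * y ^ (n - b)"
proof -
  let ?K = "p * (i + 2)" and ?g = "inverse (ev C t f) ^ (a + 1)"
  obtain P where "(f * I) ^ (a + 1) - 1 = monom 1 (d + 1) * P"
    using dvd_power_minus_1[OF I] by blast
  then have P: "f ^ (a + 1) * IP = 1 + monom 1 (d + 1) * P"
    by (simp add: IP_def power_mult_distrib algebra_simps)
  have "ev C t f ^ (a + 1) * ev C t IP = 1 + t ^ (d + 1) * ev C t P"
    using arg_cong[OF P, of "ev C t"] by (simp only: ev_simps ev_monom e_1 mult_1)
  then have inv: "?g = ev C t IP - t ^ (d + 1) * ev C t P * ?g"
    by (simp add: power_inverse field_simps)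
  define R where "R = reversed (?K + (d + 1)) v * P"
  have R: "t ^ (?K + (d + 1)) * ev C s v = ev C t (reversed (?K + (d + 1)) v)"
    using v ev_reversed[of v "?K + (d + 1)" t] by (simp add: ss_def)
  define L where "L = (\<Sum>k\<le>degree IP. smult (coeff IP k) (reversed (?K + k) v))"
  have "t ^ ?K * ev C s v * ev C t IP = (\<Sum>k\<le>degree IP. e (coeff IP k) * (t ^ (?K + k) * ev C s v))"
    by (simp add: ev_eq_sum[where q = IP, OF order.refl] sum_distrib_left power_add mult_ac)
  also have "\<dots> = (\<Sum>k\<le>degree IP. e (coeff IP k) * (ev C t (reversed (?K + k) v)
      + (\<Sum>m\<in>{1..N}. e (coeff v (?K + k + m)) * s ^ m)))"
    using v N by (intro sum.cong refl) (subst t_power_ev_s[of v _ N], auto)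
  also have "\<dots> = ev C t L + (\<Sum>k\<le>degree IP. \<Sum>m\<in>{1..N}. e (coeff IP k * coeff v (?K + k + m)) * s ^ m)"
    by (simp add: L_def ev_simps ev_smult e_simps distrib_left sum.distrib sum_distrib_left mult.assoc)
  also have "(\<Sum>k\<le>degree IP. \<Sum>m\<in>{1..N}. e (coeff IP k * coeff v (?K + k + m)) * s ^ m) =
      (\<Sum>m\<in>{1..N}. e (\<Sum>k\<le>degree IP. coeff IP k * coeff v (?K + k + m)) * s ^ m)"
    by (subst sum.swap) (simp add: e_simps sum_distrib_right)
  finally have main: "t ^ ?K * ev C s v * ev C t IP = ev C t L
      + (\<Sum>m\<in>{1..N}. e (\<Sum>k\<le>degree IP. coeff IP k * coeff v (?K + k + m)) * s ^ m)" .
  have "n = b + (n - b)" using b by simp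
  then have "ev C t f = y ^ b * y ^ (n - b)" by (metis y_power_n power_add)
  then have "inverse (ev C t f) * y ^ (n - b) = inverse (y ^ b)" by simp
  then have "inverse (y ^ (p * j)) = ?g * y ^ (n - b)"
    unfolding Frobenius_y_power[OF pj] by (simp add: power_inverse mult_ac)
  then have "t ^ (p * i) / y ^ (p * j) * t ^ (2 * p) * ev C s v =
      t ^ ?K * ev C s v * ?g * y ^ (n - b)"
    unfolding t_power_split divide_inverse by (simp only: mult_ac)
  also have "t ^ ?K * ev C s v * ?g =
      t ^ ?K * ev C s v * ev C t IP - (t ^ (?K + (d + 1)) * ev C s v) * ev C t P * ?g"
    by (subst inv) (simp add: power_add algebra_simps)
  also have "\<dots> = (\<Sum>m\<in>{1..N}. e (\<Sum>k\<le>degree IP. coeff IP k * coeff v (?K + k + m)) * s ^ m)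
      + (ev C t L - ev C t R * ?g)"
    unfolding R main by (simp add: R_def ev_simps)
  finally have "t ^ (p * i) / y ^ (p * j) * t ^ (2 * p) * ev C s v =
      (\<Sum>m\<in>{1..N}. e (\<Sum>k\<le>degree IP. coeff IP k * coeff v (?K + k + m)) * hfun C (m, n - b))
      + (ev C t L - ev C t R * ?g) * y ^ (n - b)"
    by (simp add: distrib_right sum_distrib_right hfun_eq mult.assoc)
  moreover have "ev C t L - ev C t R * ?g \<in> poly_loc"
    by (intro poly_loc_diff poly_loc_mult poly_loc_ev poly_loc_power poly_loc_inverse_f)
  ultimately show ?thesis by blast
qed

text \<open>
  As \<open>p j = a n + b\<close>, the powers of \<open>f\<close> in \<open>y\<^bsup>-pj\<^esup>\<close> and in \<open>f2\<^sup>a = s\<^bsup>nra\<^esup> f\<^sup>a\<close> cancel, so that the form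
  times \<open>y\<^sup>b\<close> is \<open>t\<^bsup>p(i+2)\<^esup> s\<^bsup>nra+2\<^esup> Q(s)\<close>. Its top exponent is at most \<open>r b - 2\<close> since
  \<open>i + 2 \<le> r j\<close>.
\<close>

lemma V_component:
  assumes pj: "p * j = n * a + b" and ij: "i + 2 \<le> r * j"
  shows "\<exists>x\<in>polar. - (t ^ (p * i) / y ^ (p * j) * t ^ (2 * p)) * ev C s (Q * f2 ^ a) * D s * y ^ b =
    (\<Sum>\<mu> | \<mu> + 2 \<le> r * b.
      e (coeff_int Q (int (r * b) - 2 + int p * (int i + 2 - int (r * j)) - int \<mu>)) * t ^ \<mu>) + x"
proof -
  let ?K = "p * (i + 2)" and ?N = "n * r * a + 2"
  have r: "r * (p * j) = n * r * a + r * b" unfolding pj by (simp add: algebra_simps)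
  have "int (r * b) + int p * (int i + 2 - int (r * j)) = int (r * b) + int ?K - int (r * (p * j))"
    by (simp add: algebra_simps)
  then have idx: "int (r * b) - 2 + int p * (int i + 2 - int (r * j)) - int \<mu> = int ?K - int ?N - int \<mu>" for \<mu>
    unfolding r by simp
  have "?K \<le> p * (r * j)" using ij by (rule mult_le_mono2)
  then have K: "?K \<le> n * r * a + r * b" using r by (simp add: mult.left_commute)
  have "ev C s f2 ^ a = s ^ (n * r * a) * ev C t f ^ a"
    by (simp only: ev_s_f2 power_mult_distrib flip: degree_f power_mult)
  then have "- (t ^ (p * i) / y ^ (p * j) * t ^ (2 * p)) * ev C s (Q * f2 ^ a) * D s * y ^ b =
      t ^ ?K * s ^ ?N * ev C s Q"
    unfolding Frobenius_y_power[OF pj] t_power_split power_add[of s] by (simp add: ev_simps D_s mult_ac)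
  moreover have "\<exists>x\<in>polar. t ^ ?K * s ^ ?N * ev C s Q =
      (\<Sum>\<mu> | \<mu> + 2 \<le> r * b. e (coeff_int Q (int ?K - int ?N - int \<mu>)) * t ^ \<mu>) + x"
  proof (cases "?N \<le> ?K")
    case True
    let ?k = "?K - ?N" and ?x = "\<Sum>m\<in>{1..degree Q}. e (coeff Q (?K - ?N + m)) * s ^ m"
    have "t ^ ?K * s ^ ?N * ev C s Q = t ^ ?k * ev C s Q"
      using True by (simp only: t_power_s_power)
    also have "\<dots> = (\<Sum>\<mu>\<le>?k. e (coeff Q (?k - \<mu>)) * t ^ \<mu>) + ?x"
      by (subst t_power_ev_s[of Q ?k "degree Q"]) (simp_all only: ev_t_reversed le_add2)
    also have "(\<Sum>\<mu>\<le>?k. e (coeff Q (?k - \<mu>)) * t ^ \<mu>) =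
        (\<Sum>\<mu> | \<mu> + 2 \<le> r * b. e (coeff_int Q (int ?K - int ?N - int \<mu>)) * t ^ \<mu>)"
    proof (rule sum.mono_neutral_cong_left[OF finite_below])
      show "{..?k} \<subseteq> {\<mu>. \<mu> + 2 \<le> r * b}" using K True by auto
      show "e (coeff Q (?k - \<mu>)) * t ^ \<mu> = e (coeff_int Q (int ?K - int ?N - int \<mu>)) * t ^ \<mu>"
        if "\<mu> \<in> {..?k}" for \<mu>
      proof -
        have "int ?K - int ?N - int \<mu> = int (?k - \<mu>)" using that True by (simp only: atMost_iff of_nat_diff)
        then show ?thesis by (simp add: coeff_int_def del: of_nat_diff of_nat_add of_nat_mult)
      qed
      show "\<forall>\<mu>\<in>{\<mu>. \<mu> + 2 \<le> r * b} - {..?k}.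
          e (coeff_int Q (int ?K - int ?N - int \<mu>)) * t ^ \<mu> = 0"
      proof
        fix \<mu> assume "\<mu> \<in> {\<mu>. \<mu> + 2 \<le> r * b} - {..?k}"
        then have "int ?K - int ?N - int \<mu> < 0" using True by (simp only: Diff_iff atMost_iff) linarith
        then show "e (coeff_int Q (int ?K - int ?N - int \<mu>)) * t ^ \<mu> = 0"
          by (simp only: coeff_int_def if_True e_0 mult_zero_left)
      qed
    qed
    finally show ?thesis by (rule bexI) (auto intro!: polar_sum polar_e_mult polar_power)
  next
    case False
    let ?q = "monom 1 (?N - ?K) * Q"
    have "t ^ ?K * s ^ ?N = s ^ (?N - ?K)" using False by (simp only: t_power_s_power)
    then have "t ^ ?K * s ^ ?N * ev C s Q = ev C s ?q" by (simp only: ev_simps ev_monom e_1 mult_1)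
    moreover have "coeff ?q 0 = 0" using False by (simp add: coeff_monom_mult)
    moreover have "(\<Sum>\<mu> | \<mu> + 2 \<le> r * b. e (coeff_int Q (int ?K - int ?N - int \<mu>)) * t ^ \<mu>) = 0"
    proof (rule sum.neutral, rule ballI)
      fix \<mu>
      have "int ?K - int ?N - int \<mu> < 0" using False by linarith
      then show "e (coeff_int Q (int ?K - int ?N - int \<mu>)) * t ^ \<mu> = 0"
        by (simp only: coeff_int_def if_True e_0 mult_zero_left)
    qed
    ultimately show ?thesis unfolding polar_def by (intro bexI[of _ "ev C s ?q"]) auto
  qed
  ultimately show ?thesis unfolding idx by simp
qed

lemma alphaU_poly_loc:
  assumes "1 \<le> b" "b + 1 \<le> n"
  shows "alphaU n f C (m, n - b) * y ^ b \<in> poly_loc"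
  using alphaU_y[of "n - b" m] assms
  by (simp add: poly_loc_sum poly_loc_mult poly_loc_e poly_loc_power poly_loc_t)

lemma alphaV_polar:
  assumes "1 \<le> b" "b + 1 \<le> n"
  shows "alphaV n r f C (m, n - b) * y ^ b \<in> polar"
proof -
  have "alphaV n r f C (m, n - b) * y ^ b = (\<Sum>q = 0..m. e (alpha_coeff m (n - b) q) * s ^ (m + 1 - q))"
    using alphaV_y[of "n - b" m] assms by simp
  also have "\<dots> \<in> polar" by (intro polar_sum polar_e_mult polar_power) simp
  finally show ?thesis .
qed

text \<open>
  The bound \<open>r b - 2\<close> on the exponents is where \<open>m \<ge> r (n - b)\<close> enters: \<open>\<mu> + m + 1 \<le> deg f = n r - 1\<close>.
\<close>

lemma alphaU_coeffs:
  assumes b: "1 \<le> b" "b + 1 \<le> n" and m: "r * (n - b) \<le> m"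
  shows "alphaU n f C (m, n - b) * y ^ b = (\<Sum>\<mu> | \<mu> + 2 \<le> r * b.
    e ((of_nat (n * (\<mu> + 1)) - of_nat (b * (\<mu> + m + 1))) / of_nat n * coeff f (\<mu> + m + 1)) * t ^ \<mu>)"
proof -
  have nb: "(of_nat (n - b) :: 'k) = of_nat n - of_nat b" using b by (intro of_nat_diff) simp
  have "alphaU n f C (m, n - b) * y ^ b = (\<Sum>q = m + 1..degree f. e (alpha_coeff m (n - b) q) * t ^ (q - (m + 1)))"
    using alphaU_y[of "n - b" m] b by simp
  also have "\<dots> = (\<Sum>\<mu> | \<mu> + m + 1 \<le> degree f. e (alpha_coeff m (n - b) (\<mu> + m + 1)) * t ^ \<mu>)"
    by (rule sum.reindex_bij_witness[of _ "\<lambda>\<mu>. \<mu> + m + 1" "\<lambda>q. q - (m + 1)"]) auto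
  also have "\<dots> = (\<Sum>\<mu> | \<mu> + 2 \<le> r * b. e (alpha_coeff m (n - b) (\<mu> + m + 1)) * t ^ \<mu>)"
    (is "_ = ?S")
  proof (rule sum.mono_neutral_left[OF finite_below])
    have "r * (n - b) + r * b = r * (n - b + b)" by (simp only: distrib_left)
    also have "\<dots> = degree f + 1" using b degree_f by (simp add: mult.commute)
    finally show "{\<mu>. \<mu> + m + 1 \<le> degree f} \<subseteq> {\<mu>. \<mu> + 2 \<le> r * b}" using m by auto
  qed (auto simp: alpha_coeff_def coeff_eq_0)
  finally have "alphaU n f C (m, n - b) * y ^ b = ?S" .
  moreover have "alpha_coeff m (n - b) (\<mu> + m + 1) =
      (of_nat (n * (\<mu> + 1)) - of_nat (b * (\<mu> + m + 1))) / of_nat n * coeff f (\<mu> + m + 1)" for \<mu>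
    unfolding alpha_coeff_def of_nat_mult nb by (simp add: algebra_simps)
  ultimately show ?thesis by (simp only:)
qed

text \<open>
  In \<open>d(X y\<^bsup>n-b\<^esup>) y\<^sup>b\<close> the powers of \<open>y\<close> combine to \<open>y\<^sup>n = f\<close> and \<open>n y\<^bsup>n-1\<^esup> dy = f' dt\<close>.
\<close>

lemma D_component_poly_loc:
  assumes "b + 1 \<le> n" "X \<in> poly_loc"
  shows "D (X * y ^ (n - b)) * y ^ b \<in> poly_loc"
proof -
  have "n - 1 = n - b - 1 + b" "n = n - b + b" using assms by simp_all
  then have n: "y ^ (n - 1) = y ^ (n - b - 1) * y ^ b" "y ^ n = y ^ (n - b) * y ^ b" by (metis power_add)+
  have "D (X * y ^ (n - b)) * y ^ b = X * (e (of_nat (n - b)) * (y ^ (n - 1) * D y)) + y ^ n * D X"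
    unfolding n by (simp add: D_mult D_power e_simps algebra_simps)
  also have "y ^ (n - 1) * D y = e (inverse (of_nat n)) * ev C t (pderiv f)"
    using D_y by (simp add: ring_hom_inverse[OF hom_e] e_simps field_simps)
  also have "X * (e (of_nat (n - b)) * (e (inverse (of_nat n)) * ev C t (pderiv f))) + y ^ n * D X \<in> poly_loc"
    unfolding y_power_n by (intro poly_loc_add poly_loc_mult poly_loc_e poly_loc_ev assms poly_loc_D)
  finally show ?thesis .
qed

lemma sum_h_component:
  assumes "1 \<le> b" "b + 1 \<le> n"
  shows "(\<Sum>x\<in>h_index n r. e (if x \<in> h_index n r \<and> snd x = n - b then c (fst x) else 0) * G x) =
    (\<Sum>m\<in>{1..<r * (n - b)}. e (c m) * G (m, n - b))" (is "sum ?F _ = ?S")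
proof -
  have "sum ?F (h_index n r) = (\<Sum>j\<in>{1..<n}. if j = n - b then ?S else 0)"
    unfolding sum_h_index
  proof (rule sum.cong[OF refl])
    fix j assume "j \<in> {1..<n}"
    then have "?F (i, j) = (if j = n - b then e (c i) * G (i, j) else 0)" if "i \<in> {1..<r * j}" for i
      using that by (auto simp: h_index_def)
    then have "(\<Sum>i\<in>{1..<r * j}. ?F (i, j)) = (\<Sum>i\<in>{1..<r * j}. if j = n - b then e (c i) * G (i, j) else 0)"
      by (rule sum.cong[OF refl])
    then show "(\<Sum>i\<in>{1..<r * j}. ?F (i, j)) = (if j = n - b then ?S else 0)" by simp
  qed
  also have "\<dots> = ?S" using assms by (simp add: sum.delta)
  finally show ?thesis .
qed

text \<open>
  The two expressions for the form \<open>\<omega>\<close> below agree by the cocycle condition. That on \<open>U \<inter> D(y)\<close> puts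
  \<open>\<omega> y\<^sup>b\<close> in \<open>k[t, 1/f]\<close>; that on \<open>V\<close> splits it into the claimed polynomial in \<open>t\<close> and an element of
  \<open>s k[s]\<close>, which then has to vanish.
\<close>

lemma projection_of_Frobenius:
  fixes v I Q :: "'k poly"
  assumes p: "CHAR('k) = p" "p > 0" and bez: "A * f + B * pderiv f = 1"
    and b: "1 \<le> b" "b + 1 \<le> n" and pj: "p * j = n * a + b" and ij: "i + 2 \<le> r * j"
    and v: "degree v \<le> d + 2 * p" and I: "monom 1 (d + 1) dvd f * I - 1"
    and Q: "Q * f2 ^ a = monom 1 (p - 1) + pderiv v"
  defines "IP \<equiv> I ^ (a + 1)" and "G \<equiv> t ^ (p * i) / y ^ (p * j)"
  shows "proj2 n r f C (coset (BDR r C) (G * t ^ (p - 1),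
      - (G * t ^ (2 * p)) * (s ^ (p - 1) + ev C s (pderiv v)) * D s, G * t ^ (2 * p) * ev C s v)) =
    (\<Sum>\<mu> | \<mu> + 2 \<le> r * b.
         e ((\<Sum>k = 0..degree IP. \<Sum>m | r * (n - b) \<le> m \<and> m + (p * i + k) \<le> d.
              (of_nat (n * (\<mu> + 1)) - of_nat (b * (\<mu> + m + 1))) / of_nat n
              * coeff IP k * coeff f (\<mu> + m + 1) * coeff v (p * (i + 2) + k + m))
           + coeff_int Q (int (r * b) - 2 + int p * (int i + 2 - int (r * j)) - int \<mu>))
         * (t ^ \<mu> / y ^ b))"
    (is "proj2 n r f C (coset (BDR r C) (?\<eta>U, ?\<eta>V, ?\<eta>)) = ?\<omega>")
proof -
  define M where "M = r * (n - b)"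
  define c where "c m = (\<Sum>k\<le>degree IP. coeff IP k * coeff v (p * (i + 2) + k + m))" for m
  define w where "w \<mu> m = (of_nat (n * (\<mu> + 1)) - of_nat (b * (\<mu> + m + 1))) / of_nat n * coeff f (\<mu> + m + 1)" for \<mu> m
  define qc where "qc \<mu> = coeff_int Q (int (r * b) - 2 + int p * (int i + 2 - int (r * j)) - int \<mu>)" for \<mu>
  define u where "u x = (if x \<in> h_index n r \<and> snd x = n - b then c (fst x) else 0)" for x
  let ?j = "n - b"
  have j: "1 \<le> ?j" "?j + 1 \<le> n" using b by auto
  have M: "1 \<le> M" using j r_pos by (simp add: M_def Suc_le_eq)
  have u_sum: "(\<Sum>x\<in>h_index n r. e (u x) * F x) = (\<Sum>m\<in>{1..<M}. e (c m) * F (m, ?j))" for F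
    unfolding u_def M_def by (rule sum_h_component[OF b])
  obtain X where X: "X \<in> poly_loc" and "G * t ^ (2 * p) * ev C s v =
      (\<Sum>m\<in>{1..M + d}. e (\<Sum>k\<le>degree IP. coeff IP k * coeff v (p * (i + 2) + k + m)) * hfun C (m, ?j)) + X * y ^ ?j"
    using h_component[OF b pj v I, of "M + d" i] unfolding G_def IP_def by auto
  then have \<eta>: "?\<eta> = (\<Sum>m\<in>{1..M + d}. e (c m) * hfun C (m, ?j)) + X * y ^ ?j" by (simp only: c_def)
  define hU where "hU = X * y ^ ?j"
  define hV where "hV = (\<Sum>m\<in>{M..M + d}. e (c m) * hfun C (m, ?j))"
  have split: "(\<Sum>m\<in>{1..M + d}. e (c m) * hfun C (m, ?j)) = (\<Sum>m\<in>{1..<M}. e (c m) * hfun C (m, ?j)) + hV"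
  proof -
    have "{1..M + d} = {1..<M} \<union> {M..M + d}" using M by auto
    then show ?thesis unfolding hV_def by (simp only:) (rule sum.union_disjoint, auto)
  qed
  have h: "hU \<in> OU C" "hV \<in> OV r C"
  proof -
    obtain K g where "X * ev C t f ^ K = ev C t g" using X by (auto simp: poly_loc_def)
    then have "X = ev C t g * inverse (ev C t f) ^ K" by (simp add: power_inverse field_simps)
    then show "hU \<in> OU C"
      unfolding hU_def by (simp only:) (intro OU_mult OU_ev OU_power OU_inverse_f OU_y)
    show "hV \<in> OV r C" unfolding hV_def hfun_eq M_def by (intro OV_sum OV_mult OV_e OV_monomial) simp
  qed
  have cocycle: "?\<eta>U = ?\<eta>V + D ?\<eta>"
  proof -
    have k: "(of_nat p :: 'a) = 0"
      using p(1) of_nat_CHAR[where 'a='k] ring_hom_of_nat[OF hom_e, of p] by simp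
    have g: "G * t ^ (2 * p) = (t ^ (i + 2) * inverse y ^ j) ^ p"
    proof -
      have "(t ^ (i + 2) * inverse y ^ j) ^ p = t ^ (p * (i + 2)) * inverse (y ^ (p * j))"
        by (simp only: power_mult_distrib power_inverse mult.commute[of p] power_mult)
      then show ?thesis by (simp only: G_def t_power_split divide_inverse mult_ac)
    qed
    have "D (G * t ^ (2 * p)) = 0" unfolding g D_power by (simp add: k)
    then have "D ?\<eta> = G * t ^ (2 * p) * (ev C s (pderiv v) * D s)" by (subst D_mult) (simp add: D_ev)
    then have "?\<eta>V + D ?\<eta> = - (G * t ^ (2 * p)) * s ^ (p - 1) * D s"
      by (simp only:) (simp add: algebra_simps)
    also have "\<dots> = G * (t ^ (2 * p) * s ^ (p - 1 + 2))"
      by (simp add: D_s power_add power2_eq_square mult_ac)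
    also have "t ^ (2 * p) * s ^ (p - 1 + 2) = t ^ (p - 1)"
      using p(2) by (subst t_power_s_power) auto
    finally show ?thesis by simp
  qed
  have hD: "D (hfun C (m, ?j)) = alphaU n f C (m, ?j) + alphaV n r f C (m, ?j)" for m
    by (rule D_hfun[OF j])
  let ?aU = "\<Sum>m\<in>{1..<M}. e (c m) * alphaU n f C (m, ?j)"
  let ?aV = "\<Sum>m\<in>{1..<M}. e (c m) * alphaV n r f C (m, ?j)"
  have D\<eta>: "D ?\<eta> = ?aU + ?aV + D hV + D hU"
    unfolding \<eta> split by (simp add: D_add D_sum D_e_mult hD hU_def distrib_left sum.distrib)
  \<comment> \<open>the global form as seen on \<open>V\<close>; the next fact is its expression on \<open>U \<inter> D(y)\<close>\<close>
  define \<omega> where "\<omega> = ?\<eta>V + ?aV + D hV"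
  have \<omega>U: "\<omega> = ?\<eta>U - ?aU - D hU" unfolding \<omega>_def cocycle D\<eta> by simp
  have "\<omega> * y ^ b \<in> poly_loc"
  proof -
    have "?\<eta>U * y ^ b = t ^ (p * i + (p - 1)) * inverse (ev C t f) ^ a"
      unfolding G_def Frobenius_y_power[OF pj] by (simp add: power_inverse power_add field_simps)
    also have "\<dots> \<in> poly_loc" by (intro poly_loc_mult poly_loc_power poly_loc_t poly_loc_inverse_f)
    finally have 1: "?\<eta>U * y ^ b \<in> poly_loc" .
    have 2: "?aU * y ^ b \<in> poly_loc"
      unfolding sum_distrib_right mult.assoc by (intro poly_loc_sum poly_loc_mult poly_loc_e alphaU_poly_loc[OF b])
    have 3: "D hU * y ^ b \<in> poly_loc" unfolding hU_def by (rule D_component_poly_loc[OF b(2) X])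
    show ?thesis using poly_loc_diff[OF poly_loc_diff[OF 1 2] 3] by (simp add: \<omega>U left_diff_distrib)
  qed
  \<comment> \<open>three contributions to the polar part, whose sum turns out to be zero\<close>
  obtain x1 where x1: "x1 \<in> polar" "?\<eta>V * y ^ b = (\<Sum>\<mu> | \<mu> + 2 \<le> r * b. e (qc \<mu>) * t ^ \<mu>) + x1"
  proof -
    have "s ^ (p - 1) + ev C s (pderiv v) = ev C s (Q * f2 ^ a)" by (simp only: Q ev_simps ev_monom e_1 mult_1)
    then show ?thesis using V_component[OF pj ij, of Q] that unfolding G_def qc_def by auto
  qed
  have x2: "?aV * y ^ b \<in> polar"
    unfolding sum_distrib_right mult.assoc by (intro polar_sum polar_e_mult alphaV_polar[OF b])
  define x3 where "x3 = (\<Sum>m\<in>{M..M + d}. e (c m) * (alphaV n r f C (m, ?j) * y ^ b))"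
  have x3: "x3 \<in> polar" unfolding x3_def by (intro polar_sum polar_e_mult alphaV_polar[OF b])
  have "D hV * y ^ b = (\<Sum>m\<in>{M..M + d}. e (c m) * (alphaU n f C (m, ?j) * y ^ b)) + x3"
    by (simp add: hV_def x3_def D_sum D_e_mult hD sum_distrib_right distrib_left distrib_right sum.distrib mult.assoc)
  also have "(\<Sum>m\<in>{M..M + d}. e (c m) * (alphaU n f C (m, ?j) * y ^ b)) =
      (\<Sum>m\<in>{M..M + d}. e (c m) * (\<Sum>\<mu> | \<mu> + 2 \<le> r * b. e (w \<mu> m) * t ^ \<mu>))"
    unfolding w_def by (intro sum.cong refl) (simp add: alphaU_coeffs[OF b] M_def)
  also have "\<dots> = (\<Sum>\<mu> | \<mu> + 2 \<le> r * b. e (\<Sum>m\<in>{M..M + d}. c m * w \<mu> m) * t ^ \<mu>)"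
    unfolding sum_distrib_left by (subst sum.swap) (simp add: e_simps sum_distrib_right mult.assoc)
  finally have x3': "D hV * y ^ b = (\<Sum>\<mu> | \<mu> + 2 \<le> r * b. e (\<Sum>m\<in>{M..M + d}. c m * w \<mu> m) * t ^ \<mu>) + x3" .
  let ?P = "\<Sum>\<mu> | \<mu> + 2 \<le> r * b. e ((\<Sum>m\<in>{M..M + d}. c m * w \<mu> m) + qc \<mu>) * t ^ \<mu>"
  have eq: "\<omega> * y ^ b = ?P + (x1 + ?aV * y ^ b + x3)"
    unfolding \<omega>_def distrib_right[of _ _ "y ^ b"] x1(2) x3'
    by (simp add: e_simps distrib_right sum.distrib)
  have "x1 + ?aV * y ^ b + x3 \<in> polar" by (intro polar_add x1 x2 x3)
  moreover have "x1 + ?aV * y ^ b + x3 \<in> poly_loc"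
  proof -
    have "?P \<in> poly_loc" by (intro poly_loc_sum poly_loc_mult poly_loc_e poly_loc_power poly_loc_t)
    then have "\<omega> * y ^ b - ?P \<in> poly_loc" using \<open>\<omega> * y ^ b \<in> poly_loc\<close> by (intro poly_loc_diff)
    then show ?thesis by (simp add: eq)
  qed
  ultimately have "x1 + ?aV * y ^ b + x3 = 0" using poly_loc_polar f0 by blast
  then have "\<omega> = ?P / y ^ b" using eq by (simp add: field_simps)
  also have "\<dots> = (\<Sum>\<mu> | \<mu> + 2 \<le> r * b. e ((\<Sum>m\<in>{M..M + d}. c m * w \<mu> m) + qc \<mu>) * (t ^ \<mu> / y ^ b))"
    by (simp add: sum_divide_distrib)
  finally have \<omega>_sum: "\<omega> = \<dots>" .
  have coeffs: "(\<Sum>m\<in>{M..M + d}. c m * w \<mu> m) =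
      (\<Sum>k = 0..degree IP. \<Sum>m | r * (n - b) \<le> m \<and> m + (p * i + k) \<le> d.
              (of_nat (n * (\<mu> + 1)) - of_nat (b * (\<mu> + m + 1))) / of_nat n
              * coeff IP k * coeff f (\<mu> + m + 1) * coeff v (p * (i + 2) + k + m))" for \<mu>
  proof -
    have "(\<Sum>m\<in>{M..M + d}. c m * w \<mu> m) =
        (\<Sum>k = 0..degree IP. \<Sum>m\<in>{M..M + d}. coeff IP k * coeff v (p * (i + 2) + k + m) * w \<mu> m)"
      unfolding c_def sum_distrib_right by (subst sum.swap) (simp add: atLeast0AtMost)
    also have "\<dots> = (\<Sum>k = 0..degree IP. \<Sum>m | r * (n - b) \<le> m \<and> m + (p * i + k) \<le> d.
        coeff IP k * coeff v (p * (i + 2) + k + m) * w \<mu> m)"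
    proof (rule sum.cong[OF refl], rule sum.mono_neutral_right)
      fix k
      show "\<forall>m\<in>{M..M + d} - {m. r * (n - b) \<le> m \<and> m + (p * i + k) \<le> d}.
          coeff IP k * coeff v (p * (i + 2) + k + m) * w \<mu> m = 0"
      proof
        fix m assume "m \<in> {M..M + d} - {m. r * (n - b) \<le> m \<and> m + (p * i + k) \<le> d}"
        \<comment> \<open>beyond the range of the inner sum the index exceeds \<open>d + 2 p\<close>, hence \<open>deg v\<close>\<close>
        then have "m + (p * i + k) > d" by (auto simp: M_def)
        then have "p * (i + 2) + k + m > degree v" using v by (simp add: distrib_left)
        then show "coeff IP k * coeff v (p * (i + 2) + k + m) * w \<mu> m = 0" by (simp add: coeff_eq_0)
      qed
    qed (auto simp: M_def)
    finally show ?thesis by (simp only: w_def mult_ac)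
  qed
  have \<omega>_eq: "\<omega> = ?\<omega>" unfolding \<omega>_sum coeffs qc_def ..
  have "\<omega> \<in> H0 r C" unfolding \<omega>_eq by (rule form_in_H0[OF bez b])
  moreover have "?\<eta>U = \<omega> + (\<Sum>x\<in>h_index n r. e (u x) * alphaU n f C x) + D hU"
    unfolding u_sum \<omega>U by simp
  moreover have "?\<eta>V = \<omega> - (\<Sum>x\<in>h_index n r. e (u x) * alphaV n r f C x) - D hV"
    unfolding u_sum \<omega>_def by simp
  moreover have "?\<eta> = (\<Sum>x\<in>h_index n r. e (u x) * hfun C x) + hU + hV"
    unfolding u_sum \<eta> split by (simp add: hU_def)
  ultimately have "proj2 n r f C (coset (BDR r C) (?\<eta>U, ?\<eta>V, ?\<eta>)) = \<omega>"
    using h by (intro proj2_eq[where u = u]) (auto simp: u_def)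
  then show ?thesis by (simp only: \<omega>_eq)
qed

end

section \<open>The divided Frobenius on a basis form\<close>

lemma omega_index_eq: "omega_index n r = (\<lambda>(j, i). (i, j)) ` (SIGMA j:{1..<n}. {..<r * j - 1})"
  by (auto simp: omega_index_def image_iff)

lemma finite_omega_index: "finite (omega_index n r)"
  by (simp add: omega_index_eq)

lemma sum_omega_index: "(\<Sum>x\<in>omega_index n r. g x) = (\<Sum>j\<in>{1..<n}. \<Sum>i<r * j - 1. g (i, j))"
  unfolding omega_index_eq by (subst sum.reindex) (auto simp: inj_on_def sum.Sigma split_def)

context superelliptic_field
begin

lemma ev2_pCons: "ev2 C x w (pCons q P) = ev C x q + w * ev2 C x w P"
  by (simp add: ev2_def map_poly_pCons ev_simps)

lemma ev2_in_subring:
  assumes "\<And>a. e a \<in> A" "\<And>g h. g \<in> A \<Longrightarrow> h \<in> A \<Longrightarrow> g + h \<in> A"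
    "\<And>g h. g \<in> A \<Longrightarrow> h \<in> A \<Longrightarrow> g * h \<in> A" "x \<in> A" "w \<in> A"
  shows "ev2 C x w P \<in> A"
proof -
  have zero: "0 \<in> A" using assms(1)[of 0] by simp
  have "ev C x q \<in> A" for q
    by (induction q) (auto simp: ev_pCons ev_simps zero intro: assms)
  then show ?thesis
    by (induction P) (auto simp: ev2_pCons ev2_simps zero intro: assms)
qed

lemma D_ev2_eq_0: "D x = 0 \<Longrightarrow> D w = 0 \<Longrightarrow> D (ev2 C x w P) = 0"
  by (induction P) (simp_all add: ev2_pCons ev2_simps D_0 D_add D_mult D_ev)

text \<open>
  Multiplied by \<open>y\<^sup>n\<close>, a relation becomes one between powers of \<open>y\<close> below the \<open>n\<close>-th.
\<close>

lemma omega_independent: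
  assumes u: "(\<Sum>x\<in>omega_index n r. e (u x) * omega C x) = 0" and x: "x \<in> omega_index n r"
  shows "u x = 0"
proof -
  obtain i j where ij: "x = (i, j)" "1 \<le> j" "j < n" "i < r * j - 1"
    using x by (auto simp: omega_index_def)
  define A where "A j = (if j = 0 then 0 else \<Sum>i<r * (n - j) - 1. monom (u (i, n - j)) i)" for j
  have "0 = (\<Sum>x\<in>omega_index n r. e (u x) * omega C x) * y ^ n" by (simp add: u)
  also have "\<dots> = (\<Sum>j\<in>{1..<n}. ev C t (\<Sum>i<r * j - 1. monom (u (i, j)) i) * y ^ (n - j))"
    unfolding sum_omega_index sum_distrib_right
  proof (rule sum.cong[OF refl])
    fix j assume "j \<in> {1..<n}"
    then have "n = n - j + j" by simp
    then have "y ^ n = y ^ (n - j) * y ^ j" by (metis power_add)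
    then show "(\<Sum>i<r * j - 1. e (u (i, j)) * omega C (i, j) * y ^ n) =
        ev C t (\<Sum>i<r * j - 1. monom (u (i, j)) i) * y ^ (n - j)"
      by (simp add: omega_def ev_simps ev_monom sum_distrib_right mult.assoc)
  qed
  also have "\<dots> = (\<Sum>j\<in>{1..<n}. ev C t (A j) * y ^ j)"
    by (rule sum.reindex_bij_witness[of _ "\<lambda>j. n - j" "\<lambda>j. n - j"]) (auto simp: A_def)
  also have "\<dots> = (\<Sum>j<n. ev C t (A j) * y ^ j)"
    by (rule sum.mono_neutral_left) (auto simp: A_def ev_simps Suc_le_eq)
  finally have "A (n - j) = 0" using ij by (intro y_powers_independent) auto
  then have "(\<Sum>i<r * j - 1. monom (u (i, j)) i) = 0" using ij by (simp add: A_def)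
  then have "coeff (\<Sum>i<r * j - 1. monom (u (i, j)) i) i = 0" by simp
  then show ?thesis using ij by (simp add: coeff_sum coeff_monom)
qed

lemma omega_coords_omega:
  assumes "x \<in> omega_index n r"
  shows "omega_coords n r C (omega C x) = (\<lambda>x'. if x' = x then 1 else 0)" (is "_ = ?u")
  unfolding omega_coords_def
proof (rule the_equality)
  have "(\<Sum>x'\<in>omega_index n r. e (?u x') * omega C x') = (\<Sum>x'\<in>omega_index n r. if x' = x then omega C x' else 0)"
    by (intro sum.cong) auto
  then have *: "omega C x = (\<Sum>x'\<in>omega_index n r. e (?u x') * omega C x')"
    using assms by (simp add: finite_omega_index)
  then show "(\<forall>x'. x' \<notin> omega_index n r \<longrightarrow> ?u x' = 0) \<and>
      omega C x = (\<Sum>x'\<in>omega_index n r. e (?u x') * omega C x')" using assms by auto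
  fix u assume u: "(\<forall>x'. x' \<notin> omega_index n r \<longrightarrow> u x' = 0) \<and>
      omega C x = (\<Sum>x'\<in>omega_index n r. e (u x') * omega C x')"
  have "(\<Sum>x'\<in>omega_index n r. e (u x' - ?u x') * omega C x') =
      (\<Sum>x'\<in>omega_index n r. e (u x') * omega C x') - (\<Sum>x'\<in>omega_index n r. e (?u x') * omega C x')"
    by (simp only: e_simps left_diff_distrib sum_subtractf)
  also have "\<dots> = 0" using u * by simp
  finally have d: "u x' - ?u x' = 0" if "x' \<in> omega_index n r" for x'
    by (rule omega_independent) (rule that)
  show "u = ?u"
  proof
    fix x'
    show "u x' = ?u x'"
    proof (cases "x' \<in> omega_index n r")
      case True
      from d[OF this] show ?thesis by (simp only: right_minus_eq)
    next
      case False
      then have "u x' = 0" "x' \<noteq> x" using u assms by blast+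
      then show ?thesis by simp
    qed
  qed
qed

end

lemma (in superelliptic_curve) h_coords_0: "h_coords n r C (coset B1 0) = (\<lambda>_. 0)"
  by (rule h_coords_eq) simp_all

locale superelliptic_Frobenius = superelliptic_curve n f C r + base: superelliptic_field n f' C'
  for n :: nat and f f' :: "'k::field poly" and C :: "('k, 'a::field) ffield" and r :: nat
    and C' :: "('k, 'b::field) ffield" +
  fixes p :: nat and Fs :: "'b \<Rightarrow> 'a"
  assumes prime_p: "prime p" and char_p: "CHAR('k) = p" and frob: "relative_frobenius p C' C Fs"
begin

lemma p_pos: "p > 0"
  using prime_p by (rule prime_gt_0_nat)

lemma hom_Fs: "is_ring_hom Fs" and Fs_e: "Fs (emb C' a) = e a"
  and Fs_t: "Fs (tt C') = t ^ p" and Fs_y: "Fs (yy C') = y ^ p"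
  using frob by (simp_all add: relative_frobenius_def)

lemmas Fs_simps = ring_homs[OF hom_Fs] ring_hom_divide[OF hom_Fs] ring_hom_inverse[OF hom_Fs]

lemma Fs_s: "Fs (ss C') = s ^ p"
  by (simp add: ss_def Fs_simps Fs_t power_inverse)

lemma Fs_z: "Fs (zz r C') = z ^ p"
  by (simp add: zz_def Fs_simps Fs_s Fs_y power_mult_distrib mult.commute flip: power_mult)

lemma Fs_ev: "Fs (ev C' x q) = ev C (Fs x) q"
  by (induction q) (simp_all add: base.ev_pCons ev_pCons base.ev_simps ev_simps Fs_simps Fs_e)

lemma Fs_ev2: "Fs (ev2 C' x w P) = ev2 C (Fs x) (Fs w) P"
  by (induction P) (simp_all add: base.ev2_pCons ev2_pCons base.ev2_simps ev2_simps Fs_simps Fs_ev)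

lemma D_p_power: "D (g ^ p) = 0"
proof -
  have "(of_nat p :: 'a) = 0"
    using char_p of_nat_CHAR[where 'a='k] ring_hom_of_nat[OF hom_e, of p] by simp
  then show ?thesis by (simp add: D_power)
qed

text \<open>
  Images under \<open>F\<^sup>#\<close> are rational expressions in \<open>p\<close>-th powers, so their differentials vanish; this makes
  \<open>(0, 0, F\<^sup>#(x))\<close> a coboundary whenever the class of \<open>x\<close> is zero.
\<close>

lemma Fs_OU: "x \<in> OU C' \<Longrightarrow> Fs x \<in> OU C" "x \<in> OU C' \<Longrightarrow> D (Fs x) = 0"
proof -
  assume "x \<in> OU C'"
  then obtain P m where "x = ev2 C' (tt C') (yy C') P / yy C' ^ m" by (auto simp: OU_def)
  then have x: "Fs x = ev2 C (t ^ p) (y ^ p) P * (inverse y ^ m) ^ p"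
    by (simp add: Fs_simps Fs_ev2 Fs_t Fs_y divide_inverse power_inverse mult.commute flip: power_mult)
  have "t \<in> OU C" using OU_ev[of "monom 1 1"] by (simp add: ev_monom)
  then have "ev2 C (t ^ p) (y ^ p) P \<in> OU C"
    by (intro ev2_in_subring OU_power OU_y OU_e OU_add OU_mult)
  then show "Fs x \<in> OU C" unfolding x by (intro OU_mult OU_power OU_inverse_y)
  show "D (Fs x) = 0" unfolding x by (simp add: D_mult D_p_power D_ev2_eq_0)
qed

lemma Fs_OV: "x \<in> OV r C' \<Longrightarrow> Fs x \<in> OV r C" "x \<in> OV r C' \<Longrightarrow> D (Fs x) = 0"
proof -
  assume "x \<in> OV r C'"
  then obtain P where "x = ev2 C' (ss C') (zz r C') P" by (auto simp: OV_def)
  then have x: "Fs x = ev2 C (s ^ p) (z ^ p) P" by (simp add: Fs_ev2 Fs_s Fs_z)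
  show "Fs x \<in> OV r C" unfolding x
    by (intro ev2_in_subring OV_power OV_s OV_z OV_e OV_add OV_mult)
  show "D (Fs x) = 0" unfolding x by (simp add: D_p_power D_ev2_eq_0)
qed

lemma Phi'_form:
  "Phi' p r v C' C Fs (\<omega>, coset (OU_plus_OV r C') 0) =
    coset (BDR r C) (fU p C Fs \<omega>, fV p v C' C Fs \<omega>, hUV p v C Fs \<omega>)" (is "_ = coset _ ?x")
proof -
  have "coset (BDR r C) (?x + (0, 0, Fs h)) = coset (BDR r C) ?x" if "h \<in> coset (OU_plus_OV r C') 0" for h
  proof -
    obtain hU hV where h: "h = hU + hV" "hU \<in> OU C'" "hV \<in> OV r C'"
      using \<open>h \<in> _\<close> by (auto simp: coset_def OU_plus_OV_def)
    have "(0, 0, Fs h) = (D (Fs hU), - D (Fs hV), Fs hU + Fs hV)"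
      using h by (simp add: Fs_OU Fs_OV Fs_simps)
    also have "\<dots> \<in> BDR r C" unfolding BDR_def using h Fs_OU(1) Fs_OV(1) by blast
    finally have "(?x + (0, 0, Fs h)) - ?x \<in> BDR r C" by simp
    then show ?thesis unfolding coset_BDR .
  qed
  moreover have "0 \<in> coset (OU_plus_OV r C') 0"
  proof -
    have "0 = ev2 C' (ss C') (zz r C') 0" by (simp add: base.ev2_simps)
    then have "0 \<in> OV r C'" by (auto simp: OV_def)
    then have "0 + 0 \<in> OU_plus_OV r C'"
      using base.OU_e[of 0] unfolding OU_plus_OV_def by (auto intro!: exI[of _ 0])
    then show ?thesis by (simp add: coset_def)
  qed
  ultimately show ?thesis unfolding Phi'_def by auto
qed

lemma base_change_omega:
  assumes "x \<in> omega_index n r"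
  shows "base_change p n r C' C (omega C x, coset B1 0) = (omega C' x, coset (OU_plus_OV r C') 0)"
proof -
  have "(\<Sum>x'\<in>omega_index n r. emb C' ((if x' = x then 1 else 0) ^ p) * omega C' x') =
      (\<Sum>x'\<in>omega_index n r. if x' = x then omega C' x' else 0)"
    using p_pos by (intro sum.cong) (auto simp: zero_power)
  then show ?thesis
    using p_pos assms
    by (simp add: base_change_def omega_coords_omega h_coords_0 finite_omega_index zero_power)
qed

lemma Phi_omega:
  assumes "x \<in> omega_index n r"
  shows "Phi p n r v C' C Fs (omega C x, coset B1 0) =
    coset (BDR r C) (Fs (omega C' x) * t ^ (p - 1),
      - (Fs (omega C' x) * t ^ (2 * p)) * (s ^ (p - 1) + ev C s (pderiv v)) * D s,
      Fs (omega C' x) * t ^ (2 * p) * ev C s v)"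
proof -
  have "Fs (der C' (ss C')) = - (s ^ (2 * p))"
    by (simp add: base.D_s Fs_simps Fs_s mult.commute flip: power_mult)
  moreover have "inverse (s ^ (2 * p)) = t ^ (2 * p)" by (simp add: ss_def power_inverse)
  ultimately have "Fs (\<omega> / der C' (ss C')) = - (Fs \<omega> * t ^ (2 * p))" for \<omega>
    unfolding ring_hom_divide[OF hom_Fs] by (simp add: divide_inverse)
  then show ?thesis
    unfolding Phi_def base_change_omega[OF assms] Phi'_form fU_def fV_def hUV_def by simp
qed

end

lemma (in witt_ring) red_poly_at_infinity:
  "red_poly (poly_at_infinity l G) = poly_at_infinity l (red_poly G)"
  by (intro poly_eqI) (simp add: poly_at_infinity_def coeff_red_poly coeff_sum coeff_monom red_sum
      red_0 if_distrib cong: if_cong)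

theorem proposition6p4:
  fixes p n l r i j d a b :: nat
    and wcomp :: "'w::idom \<Rightarrow> nat \<Rightarrow> 'k::{field,finite}"
    and F F2 :: "'w poly"
    and f f2 v c I IP Q :: "'k poly"
    and C :: "('k, 'a::field) ffield"
    and C' :: "('k, 'b::field) ffield"
    and Fs :: "'b \<Rightarrow> 'a"
  assumes "prime p" and "CHAR('k) = p"
    and "witt_vectors p wcomp"
    and "n \<ge> 1" and "coprime n p"
    and "l \<ge> 1" and "n dvd l + 1" and "\<not> p dvd l" and "r = (l + 1) div n"
    and "degree F = l" and "\<exists>A B. A * F + B * pderiv F = 1"
    and "F2 = poly_at_infinity l F"
    and "f = map_poly (witt_red wcomp) F" and "f2 = map_poly (witt_red wcomp) F2"
    and "degree f = l" and "poly f 0 \<noteq> 0"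
    and "function_field n f C"
    and "function_field n (frob_poly p f) C'"
    and "relative_frobenius p C' C Fs"
    and "eq_p_times p wcomp
           (F2 ^ p - pcompose (map_poly (witt_frob p wcomp) F2) (monom 1 p))
           (v * pderiv f2 ^ p - of_nat n * c * f2 ^ p)"
    and "1 \<le> j" and "j + 1 \<le> n" and "i + 2 \<le> r * j"
    and "d = degree v - 2 * p"
    and "monom 1 (d + 1) dvd f * I - 1"
    and "a = p * j div n" and "b = p * j mod n"
    and "IP = I ^ (a + 1)"
    and "Q = (monom 1 (p - 1) + pderiv v) div f2 ^ a"
  shows "1 \<le> b \<and> b + 1 \<le> n \<and>
    proj2 n r f C (Phi p n r v C' C Fs (tt C ^ i / yy C ^ j, coset (OU_plus_OV r C) 0)) =
      (\<Sum>\<mu> | \<mu> + 2 \<le> r * b.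
         emb C
          ((\<Sum>k = 0..degree IP. \<Sum>m | r * (n - b) \<le> m \<and> m + (p * i + k) \<le> d.
              (of_nat (n * (\<mu> + 1)) - of_nat (b * (\<mu> + m + 1))) / of_nat n
              * coeff IP k * coeff f (\<mu> + m + 1) * coeff v (p * (i + 2) + k + m))
           + coeff_int Q (int (r * b) - 2 + int p * (int i + 2 - int (r * j)) - int \<mu>))
         * (tt C ^ \<mu> / yy C ^ b))"
proof -
  interpret witt_ring p wcomp using assms(1-3) by unfold_locales
  have p: "p > 1" using prime_gt_1_nat[OF assms(1)] .
  have n: "n \<ge> 2" using assms(21,22) by simp
  have nr: "n * r = degree f + 1" using assms(7,9,15) by simp
  have "\<not> p dvd n" using assms(5) p by (metis coprime_absorb_right not_prime_unit assms(1))
  then have n_unit: "of_nat n \<noteq> (0 :: 'k)" using assms(2) by (simp add: of_nat_eq_0_iff_char_dvd)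
  interpret superelliptic_Frobenius n f "frob_poly p f" C r C' p Fs
    using assms n nr n_unit by unfold_locales auto
  have b_pos: "1 \<le> b"
  proof -
    have "\<not> n dvd j" using assms(21,22) by (auto dest: dvd_imp_le)
    then have "\<not> n dvd p * j" using assms(5) by (simp add: coprime_dvd_mult_right_iff)
    then show ?thesis by (simp add: assms(27) dvd_eq_mod_eq_0 Suc_le_eq)
  qed
  have b_less: "b + 1 \<le> n" using n assms(27) by (simp add: Suc_le_eq)
  have pj: "p * j = n * a + b" using assms(26,27) by simp
  obtain A B where AB: "A * F + B * pderiv F = 1" using assms(11) by blast
  have bez: "red_poly A * f + red_poly B * pderiv f = 1"
    using arg_cong[OF AB, of red_poly] by (simp add: red_poly_add red_poly_mult red_poly_pderiv assms(13))
  have f2: "f2 = poly_at_infinity (degree f) f"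
    by (simp add: assms(12,14,15) red_poly_at_infinity flip: assms(13))
  obtain A2 B2 where "A2 * f2 + B2 * pderiv f2 = 1" using bezout_f2[OF bez] f2 by blast
  then have "f2 ^ (p - 1) dvd monom 1 (p - 1) + pderiv v"
    using power_dvd_Frobenius_on_ds[OF assms(20,14)] by blast
  moreover have "a \<le> p - 1"
  proof -
    have "p * j < p * n" using assms(22) p by simp
    then have "a < p" unfolding assms(26) using n by (simp add: div_less_iff_less_mult)
    then show ?thesis by simp
  qed
  ultimately have "f2 ^ a dvd monom 1 (p - 1) + pderiv v" by (metis le_imp_power_dvd dvd_trans)
  then have Q: "Q * poly_at_infinity (degree f) f ^ a = monom 1 (p - 1) + pderiv v"
    unfolding assms(29) f2 by simp
  have idx: "(i, j) \<in> omega_index n r" using assms(21-23) by (simp add: omega_index_def)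
  have Fs: "Fs (omega C' (i, j)) = tt C ^ (p * i) / yy C ^ (p * j)"
    by (simp add: omega_def Fs_simps Fs_t Fs_y flip: power_mult)
  have "tt C ^ i / yy C ^ j = omega C (i, j)" by (simp add: omega_def)
  then have "proj2 n r f C (Phi p n r v C' C Fs (tt C ^ i / yy C ^ j, coset (OU_plus_OV r C) 0)) =
      proj2 n r f C (coset (BDR r C) (tt C ^ (p * i) / yy C ^ (p * j) * tt C ^ (p - 1),
      - (tt C ^ (p * i) / yy C ^ (p * j) * tt C ^ (2 * p)) * (ss C ^ (p - 1) + ev C (ss C) (pderiv v)) * der C (ss C),
      tt C ^ (p * i) / yy C ^ (p * j) * tt C ^ (2 * p) * ev C (ss C) v))"
    by (simp only: Phi_omega[OF idx] Fs)
  also have "\<dots> = (\<Sum>\<mu> | \<mu> + 2 \<le> r * b.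
         emb C
          ((\<Sum>k = 0..degree IP. \<Sum>m | r * (n - b) \<le> m \<and> m + (p * i + k) \<le> d.
              (of_nat (n * (\<mu> + 1)) - of_nat (b * (\<mu> + m + 1))) / of_nat n
              * coeff IP k * coeff f (\<mu> + m + 1) * coeff v (p * (i + 2) + k + m))
           + coeff_int Q (int (r * b) - 2 + int p * (int i + 2 - int (r * j)) - int \<mu>))
         * (tt C ^ \<mu> / yy C ^ b))"
    unfolding assms(28) using p assms(2,23-25) b_pos b_less
    by (intro projection_of_Frobenius[OF _ _ bez _ _ pj _ _ _ Q]) auto
  finally show ?thesis using b_pos b_less by simp
qed

end
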